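(* Let $\lambda_1,\lambda_2,\lambda_3,\lambda_4,\mu_1,\mu_3\in\mathbb{R}$ and let $G$ be a 5-dimensional real connected Lie group whose Lie algebra has a basis $\{e_1,\dots,e_5\}$ of left-invariant vector fields with, writing $\xi=e_5$, $$\begin{aligned} [e_1,\xi]&=\lambda_1e_1+\lambda_2e_2+\lambda_3e_3+\lambda_4e_4,\\ [e_2,\xi]&=\mu_1e_1-\lambda_1e_2+\mu_3e_3-\lambda_3e_4,\\ [e_3,\xi]&=-\lambda_3e_1-\lambda_4e_2+\lambda_1e_3+\lambda_2e_4,\\ [e_4,\xi]&=-\mu_3e_1+\lambda_3e_2+\mu_1e_3-\lambda_1e_4, \end{aligned}$$ and $[e_i,e_j]=0$ for $i,j\in\{1,2,3,4\}$. Let $(\varphi,\xi,\eta,g)$ be the left-invariant structure on $G$ given by $$\varphi e_1=e_3,\quad \varphi e_2=e_4,\quad \varphi e_3=-e_1,\quad \varphi e_4=-e_2,\quad \varphi e_5=0,$$ $$\xi=e_5,\quad \eta(e_i)=0\ (i=1,2,3,4),\quad \eta(e_5)=1,$$ $$g(e_1,e_1)=g(e_2,e_2)=-g(e_3,e_3)=-g(e_4,e_4)=g(e_5,e_5)=1,\quad g(e_i,e_j)=0\ (i\neq j).$$ Then the almost contact B-metric manifold $(G,\varphi,\xi,\eta,g)$ belongs to the class $\mathcal{F}_6$.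
   Context: An almost contact B-metric manifold $(M,\varphi,\xi,\eta,g)$ is a $(2n+1)$-dimensional differentiable manifold $M$ with an endomorphism $\varphi$ of the tangent bundle, a vector field $\xi$, a 1-form $\eta$, and a pseudo-Riemannian metric $g$ of signature $(n,n+1)$ ($n$ negative and $n+1$ positive directions) such that $$\varphi\xi=0,\quad \varphi^2=-\mathrm{Id}+\eta\otimes\xi,\quad \eta\circ\varphi=0,\quad \eta(\xi)=1,\quad g(\varphi x,\varphi y)=-g(x,y)+\eta(x)\eta(y)$$ for all vector fields $x,y$. Let $\nabla$ be the Levi-Civita connection of $g$ and $F(x,y,z)=g\big((\nabla_x\varphi)y,z\big)$. With $g^{ij}$ the components of the inverse matrix of $g$ with respect to a basis of the tangent space consisting of vectors $e_i$ together with $\xi$, put $$\theta(z)=g^{ij}F(e_i,e_j,z),\qquad \theta^*(z)=g^{ij}F(e_i,\varphi e_j,z)$$ (summation over repeated indices). The class $\mathcal{F}_6$ consists of the almost contact B-metric manifolds such that, for all vector fields $x,y,z$, $$F(x,y,z)=\eta(y)F(x,z,\xi)+\eta(z)F(x,y,\xi),\qquad F(\xi,y,z)=0,$$ $$F(x,y,\xi)=F(y,x,\xi)=-F(\varphi x,\varphi y,\xi),\qquad \theta=\theta^*=0.$$ *)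

theory Defs
  imports
    "HOL-Analysis.Analysis"
    "HOL-Algebra.Group"
    "HOL-Library.Function_Algebras"
begin

section \<open>Function spaces as real vector spaces\<close>

instantiation "fun" :: (type, real_vector) real_vector
begin

definition scaleR_fun_def: "a *\<^sub>R f = (\<lambda>x. a *\<^sub>R f x)"

instance
  by standard (simp_all add: scaleR_fun_def fun_eq_iff scaleR_add_right scaleR_add_left)

end

definition is_basis_of :: "'i set \<Rightarrow> ('i \<Rightarrow> 'v::real_vector) \<Rightarrow> 'v set \<Rightarrow> bool" where
  "is_basis_of I b S \<longleftrightarrow> inj_on b I \<and> independent (b ` I) \<and> span (b ` I) = S"

text \<open>Linearity of a map whose values outside the subspace \<open>S\<close> are irrelevant.\<close>

definition linear_on_subspace :: "'v::real_vector set \<Rightarrow> ('v \<Rightarrow> 'w::real_vector) \<Rightarrow> bool" where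
  "linear_on_subspace S f \<longleftrightarrow>
    (\<forall>u\<in>S. \<forall>v\<in>S. \<forall>a b. f (a *\<^sub>R u + b *\<^sub>R v) = a *\<^sub>R f u + b *\<^sub>R f v)"


section \<open>Smooth manifolds\<close>

text \<open>\<open>Ck_on k f S\<close>: \<open>f\<close> is of class \<open>C\<^sup>k\<close> on the open set \<open>S\<close>. All directional derivatives being
  of class \<open>C\<^sup>k\<close> is the right condition because domains are always finite-dimensional here.\<close>

primrec Ck_on :: "nat \<Rightarrow> ('v::real_normed_vector \<Rightarrow> 'w::real_normed_vector) \<Rightarrow> 'v set \<Rightarrow> bool" where
  "Ck_on 0 f S \<longleftrightarrow> continuous_on S f"
| "Ck_on (Suc k) f S \<longleftrightarrow>
     (\<forall>x\<in>S. f differentiable (at x)) \<and> (\<forall>v. Ck_on k (\<lambda>x. frechet_derivative f (at x) v) S)"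

definition Cinf_on :: "('v::real_normed_vector \<Rightarrow> 'w::real_normed_vector) \<Rightarrow> 'v set \<Rightarrow> bool" where
  "Cinf_on f S \<longleftrightarrow> (\<forall>k. Ck_on k f S)"

text \<open>The underlying set of a manifold is a whole type \<open>'a\<close>; the values of a chart \<open>(U, c)\<close>
  outside \<open>U\<close> are irrelevant. Atlases need not be maximal.\<close>

type_synonym ('a, 'e) atlas = "('a set \<times> ('a \<Rightarrow> 'e)) set"

definition smooth_manifold ::
    "('a::{t2_space, second_countable_topology}, 'e::euclidean_space) atlas \<Rightarrow> bool" where
  "smooth_manifold A \<longleftrightarrow>
    (\<Union>(U, c)\<in>A. U) = UNIV \<and>
    (\<forall>(U, c)\<in>A. open U \<and> open (c ` U) \<and> homeomorphism U (c ` U) c (inv_into U c)) \<and>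
    (\<forall>(U, c)\<in>A. \<forall>(V, d)\<in>A. Cinf_on (d \<circ> inv_into U c) (c ` (U \<inter> V)))"

definition euclidean_atlas :: "('e, 'e) atlas" where
  "euclidean_atlas = {(UNIV, id)}"

definition product_atlas :: "('a, 'e) atlas \<Rightarrow> ('b, 'f) atlas \<Rightarrow> ('a \<times> 'b, 'e \<times> 'f) atlas" where
  "product_atlas A B = {(U \<times> V, map_prod c d) |U c V d. (U, c) \<in> A \<and> (V, d) \<in> B}"

definition smooth_map_on ::
    "('a::topological_space, 'e::euclidean_space) atlas \<Rightarrow>
     ('b::topological_space, 'f::euclidean_space) atlas \<Rightarrow> 'a set \<Rightarrow> ('a \<Rightarrow> 'b) \<Rightarrow> bool" where
  "smooth_map_on A B W h \<longleftrightarrow>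
    continuous_on W h \<and>
    (\<forall>(U, c)\<in>A. \<forall>(V, d)\<in>B. Cinf_on (d \<circ> h \<circ> inv_into U c) (c ` (U \<inter> W \<inter> h -` V)))"

abbreviation smooth_fun_on ::
    "('a::topological_space, 'e::euclidean_space) atlas \<Rightarrow> 'a set \<Rightarrow> ('a \<Rightarrow> real) \<Rightarrow> bool" where
  "smooth_fun_on A W f \<equiv> smooth_map_on A euclidean_atlas W f"

definition smooth_near ::
    "('a::topological_space, 'e::euclidean_space) atlas \<Rightarrow> 'a \<Rightarrow> ('a \<Rightarrow> real) \<Rightarrow> bool" where
  "smooth_near A p f \<longleftrightarrow> (\<exists>W. open W \<and> p \<in> W \<and> smooth_fun_on A W f)"


section \<open>Tangent vectors and vector fields\<close>

text \<open>A tangent vector at \<open>p\<close> is the velocity of a smooth curve through \<open>p\<close>, regarded as the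
  operator \<open>f \<mapsto> (f \<circ> \<gamma>)'(0)\<close> on functions that are smooth near \<open>p\<close>. On all other functions
  it is put equal to 0, so that tangent vectors acting alike are equal. The vector space
  operations on tangent vectors and on vector fields are the pointwise ones of the function type.\<close>

type_synonym 'a tvec = "('a \<Rightarrow> real) \<Rightarrow> real"
type_synonym 'a vfield = "'a \<Rightarrow> 'a tvec"

definition smooth_curve ::
    "('a::topological_space, 'e::euclidean_space) atlas \<Rightarrow> (real \<Rightarrow> 'a) \<Rightarrow> bool" where
  "smooth_curve A \<gamma> \<longleftrightarrow> (\<exists>\<epsilon>>0. smooth_map_on euclidean_atlas A {-\<epsilon><..<\<epsilon>} \<gamma>)"

definition velocity ::
    "('a::topological_space, 'e::euclidean_space) atlas \<Rightarrow> (real \<Rightarrow> 'a) \<Rightarrow> 'a tvec" where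
  "velocity A \<gamma> = (\<lambda>f. if smooth_near A (\<gamma> 0) f then deriv (\<lambda>t. f (\<gamma> t)) 0 else 0)"

definition tangent_space ::
    "('a::topological_space, 'e::euclidean_space) atlas \<Rightarrow> 'a \<Rightarrow> 'a tvec set" where
  "tangent_space A p = {velocity A \<gamma> |\<gamma>. smooth_curve A \<gamma> \<and> \<gamma> 0 = p}"

definition smooth_vfields ::
    "('a::topological_space, 'e::euclidean_space) atlas \<Rightarrow> 'a vfield set" where
  "smooth_vfields A = {X. (\<forall>p. X p \<in> tangent_space A p) \<and>
     (\<forall>W f. open W \<and> smooth_fun_on A W f \<longrightarrow> smooth_fun_on A W (\<lambda>p. X p f))}"

definition lie_bracket ::
    "('a::topological_space, 'e::euclidean_space) atlas \<Rightarrow> 'a vfield \<Rightarrow> 'a vfield \<Rightarrow> 'a vfield" where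
  "lie_bracket A X Y = (\<lambda>p f. if smooth_near A p f
     then X p (\<lambda>q. Y q f) - Y p (\<lambda>q. X q f) else 0)"

definition differential_at ::
    "('b::topological_space, 'f::euclidean_space) atlas \<Rightarrow> ('a \<Rightarrow> 'b) \<Rightarrow> 'a \<Rightarrow> 'a tvec \<Rightarrow> 'b tvec" where
  "differential_at B h p v = (\<lambda>f. if smooth_near B (h p) f then v (f \<circ> h) else 0)"


section \<open>Lie groups\<close>

definition lie_group ::
    "'a::{t2_space, second_countable_topology} monoid \<Rightarrow> ('a, 'e::euclidean_space) atlas \<Rightarrow> bool" where
  "lie_group G A \<longleftrightarrow>
    group G \<and> carrier G = UNIV \<and> smooth_manifold A \<and>
    smooth_map_on (product_atlas A A) A UNIV (\<lambda>(x, y). x \<otimes>\<^bsub>G\<^esub> y) \<and>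
    smooth_map_on A A UNIV (\<lambda>x. inv\<^bsub>G\<^esub> x)"

definition lie_algebra ::
    "'a monoid \<Rightarrow> ('a::topological_space, 'e::euclidean_space) atlas \<Rightarrow> 'a vfield set" where
  "lie_algebra G A = {X \<in> smooth_vfields A.
     \<forall>a p. X (a \<otimes>\<^bsub>G\<^esub> p) = differential_at A (\<lambda>q. a \<otimes>\<^bsub>G\<^esub> q) p (X p)}"


section \<open>Tensor fields and metrics\<close>

text \<open>Tensor fields are given by their values at each point on tangent vectors at that point.\<close>

type_synonym 'a endo = "'a \<Rightarrow> 'a tvec \<Rightarrow> 'a tvec"
type_synonym 'a oneform = "'a \<Rightarrow> 'a tvec \<Rightarrow> real"
type_synonym 'a bilform = "'a \<Rightarrow> 'a tvec \<Rightarrow> 'a tvec \<Rightarrow> real"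

definition endo_apply :: "'a endo \<Rightarrow> 'a vfield \<Rightarrow> 'a vfield" where
  "endo_apply \<phi> X = (\<lambda>p. \<phi> p (X p))"

definition endo_field ::
    "('a::topological_space, 'e::euclidean_space) atlas \<Rightarrow> 'a endo \<Rightarrow> bool" where
  "endo_field A \<phi> \<longleftrightarrow> (\<forall>p. linear_on_subspace (tangent_space A p) (\<phi> p) \<and>
     \<phi> p ` tangent_space A p \<subseteq> tangent_space A p)"

definition oneform_field ::
    "('a::topological_space, 'e::euclidean_space) atlas \<Rightarrow> 'a oneform \<Rightarrow> bool" where
  "oneform_field A \<eta> \<longleftrightarrow> (\<forall>p. linear_on_subspace (tangent_space A p) (\<eta> p))"

definition bilform_field ::
    "('a::topological_space, 'e::euclidean_space) atlas \<Rightarrow> 'a bilform \<Rightarrow> bool" where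
  "bilform_field A g \<longleftrightarrow> (\<forall>p. \<forall>u\<in>tangent_space A p.
     linear_on_subspace (tangent_space A p) (\<lambda>v. g p u v) \<and>
     linear_on_subspace (tangent_space A p) (\<lambda>v. g p v u))"

definition smooth_endo ::
    "('a::topological_space, 'e::euclidean_space) atlas \<Rightarrow> 'a endo \<Rightarrow> bool" where
  "smooth_endo A \<phi> \<longleftrightarrow> (\<forall>X\<in>smooth_vfields A. endo_apply \<phi> X \<in> smooth_vfields A)"

definition smooth_oneform ::
    "('a::topological_space, 'e::euclidean_space) atlas \<Rightarrow> 'a oneform \<Rightarrow> bool" where
  "smooth_oneform A \<eta> \<longleftrightarrow> (\<forall>X\<in>smooth_vfields A. smooth_fun_on A UNIV (\<lambda>p. \<eta> p (X p)))"

definition smooth_bilform ::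
    "('a::topological_space, 'e::euclidean_space) atlas \<Rightarrow> 'a bilform \<Rightarrow> bool" where
  "smooth_bilform A g \<longleftrightarrow>
    (\<forall>X\<in>smooth_vfields A. \<forall>Y\<in>smooth_vfields A. smooth_fun_on A UNIV (\<lambda>p. g p (X p) (Y p)))"

definition pseudo_riemannian_metric ::
    "('a::topological_space, 'e::euclidean_space) atlas \<Rightarrow> 'a bilform \<Rightarrow> bool" where
  "pseudo_riemannian_metric A g \<longleftrightarrow>
    bilform_field A g \<and> smooth_bilform A g \<and>
    (\<forall>p. \<forall>u\<in>tangent_space A p. \<forall>v\<in>tangent_space A p. g p u v = g p v u) \<and>
    (\<forall>p. \<forall>u\<in>tangent_space A p. (\<forall>v\<in>tangent_space A p. g p u v = 0) \<longrightarrow> u = 0)"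

text \<open>Signature with \<open>m\<close> negative and \<open>r\<close> positive directions.\<close>

definition has_signature ::
    "('a::topological_space, 'e::euclidean_space) atlas \<Rightarrow> 'a bilform \<Rightarrow> nat \<Rightarrow> nat \<Rightarrow> bool" where
  "has_signature A g m r \<longleftrightarrow> (\<forall>p. \<exists>b. is_basis_of {..<m + r} b (tangent_space A p) \<and>
     (\<forall>i<m + r. \<forall>j<m + r. g p (b i) (b j) = (if i \<noteq> j then 0 else if i < m then -1 else 1)))"


section \<open>The Levi-Civita connection\<close>

definition affine_connection ::
    "('a::topological_space, 'e::euclidean_space) atlas \<Rightarrow>
     ('a vfield \<Rightarrow> 'a vfield \<Rightarrow> 'a vfield) \<Rightarrow> bool" where
  "affine_connection A nabla \<longleftrightarrow>
    (\<forall>X\<in>smooth_vfields A. \<forall>Y\<in>smooth_vfields A. nabla X Y \<in> smooth_vfields A) \<and>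
    (\<forall>X\<in>smooth_vfields A. \<forall>X'\<in>smooth_vfields A. \<forall>Y\<in>smooth_vfields A.
       nabla (X + X') Y = nabla X Y + nabla X' Y \<and> nabla Y (X + X') = nabla Y X + nabla Y X') \<and>
    (\<forall>f. smooth_fun_on A UNIV f \<longrightarrow> (\<forall>X\<in>smooth_vfields A. \<forall>Y\<in>smooth_vfields A.
       nabla (\<lambda>p. f p *\<^sub>R X p) Y = (\<lambda>p. f p *\<^sub>R nabla X Y p) \<and>
       nabla X (\<lambda>p. f p *\<^sub>R Y p) = (\<lambda>p. X p f *\<^sub>R Y p + f p *\<^sub>R nabla X Y p)))"

text \<open>The value outside smooth vector fields is fixed to make the connection unique as a function.\<close>

definition is_levi_civita ::
    "('a::topological_space, 'e::euclidean_space) atlas \<Rightarrow> 'a bilform \<Rightarrow>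
     ('a vfield \<Rightarrow> 'a vfield \<Rightarrow> 'a vfield) \<Rightarrow> bool" where
  "is_levi_civita A g nabla \<longleftrightarrow>
    affine_connection A nabla \<and>
    (\<forall>X\<in>smooth_vfields A. \<forall>Y\<in>smooth_vfields A. nabla X Y - nabla Y X = lie_bracket A X Y) \<and>
    (\<forall>X\<in>smooth_vfields A. \<forall>Y\<in>smooth_vfields A. \<forall>Z\<in>smooth_vfields A. \<forall>p.
       X p (\<lambda>q. g q (Y q) (Z q)) = g p (nabla X Y p) (Z p) + g p (Y p) (nabla X Z p)) \<and>
    (\<forall>X Y. X \<notin> smooth_vfields A \<or> Y \<notin> smooth_vfields A \<longrightarrow> nabla X Y = 0)"

definition levi_civita ::
    "('a::topological_space, 'e::euclidean_space) atlas \<Rightarrow> 'a bilform \<Rightarrow>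
     'a vfield \<Rightarrow> 'a vfield \<Rightarrow> 'a vfield" where
  "levi_civita A g = (THE nabla. is_levi_civita A g nabla)"


section \<open>Almost contact B-metric manifolds\<close>

text \<open>The model space is \<open>real ^ 'd\<close>, so that the manifold has dimension \<open>CARD('d)\<close> and the finite
  type \<open>'d\<close> can serve as the index type of bases of tangent spaces.\<close>

definition almost_contact_B_metric_manifold ::
    "('a::{t2_space, second_countable_topology}, real ^ 'd) atlas \<Rightarrow>
     'a endo \<Rightarrow> 'a vfield \<Rightarrow> 'a oneform \<Rightarrow> 'a bilform \<Rightarrow> bool" where
  "almost_contact_B_metric_manifold A \<phi> \<xi> \<eta> g \<longleftrightarrow>
    smooth_manifold A \<and>
    endo_field A \<phi> \<and> smooth_endo A \<phi> \<and> \<xi> \<in> smooth_vfields A \<and>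
    oneform_field A \<eta> \<and> smooth_oneform A \<eta> \<and> pseudo_riemannian_metric A g \<and>
    (\<exists>n. CARD('d) = 2 * n + 1 \<and> has_signature A g n (n + 1)) \<and>
    (\<forall>p. \<phi> p (\<xi> p) = 0 \<and> \<eta> p (\<xi> p) = 1) \<and>
    (\<forall>p. \<forall>x\<in>tangent_space A p. \<phi> p (\<phi> p x) = - x + \<eta> p x *\<^sub>R \<xi> p \<and> \<eta> p (\<phi> p x) = 0) \<and>
    (\<forall>p. \<forall>x\<in>tangent_space A p. \<forall>y\<in>tangent_space A p.
       g p (\<phi> p x) (\<phi> p y) = - g p x y + \<eta> p x * \<eta> p y)"

definition fundamental_F ::
    "('a::topological_space, 'e::euclidean_space) atlas \<Rightarrow> 'a endo \<Rightarrow> 'a bilform \<Rightarrow>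
     'a vfield \<Rightarrow> 'a vfield \<Rightarrow> 'a vfield \<Rightarrow> 'a \<Rightarrow> real" where
  "fundamental_F A \<phi> g X Y Z p =
    g p (levi_civita A g X (endo_apply \<phi> Y) p - \<phi> p (levi_civita A g X Y p)) (Z p)"

text \<open>The traces \<open>\<theta>\<close> and \<open>\<theta>\<^sup>*\<close> at a point \<open>p\<close> are taken over a basis of the tangent space
  at \<open>p\<close> containing \<open>\<xi>\<close>. Since \<open>F\<close> is a function of vector fields, the basis is given by vector
  fields \<open>b i\<close>; only their values at \<open>p\<close> need to form a basis, and \<open>F\<close> being tensorial, only these
  values matter. The summation indices run over the whole basis, including \<open>\<xi>\<close>.\<close>

definition adapted_basis_at ::
    "('a::topological_space, real ^ 'd) atlas \<Rightarrow> 'a vfield \<Rightarrow> ('d \<Rightarrow> 'a vfield) \<Rightarrow> 'a \<Rightarrow> bool" where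
  "adapted_basis_at A \<xi> b p \<longleftrightarrow>
    range b \<subseteq> smooth_vfields A \<and> is_basis_of UNIV (\<lambda>i. b i p) (tangent_space A p) \<and>
    (\<exists>k. b k p = \<xi> p)"

definition inverse_gram ::
    "'a bilform \<Rightarrow> ('d::finite \<Rightarrow> 'a vfield) \<Rightarrow> 'a \<Rightarrow> real ^ 'd ^ 'd" where
  "inverse_gram g b p = matrix_inv (\<chi> i j. g p (b i p) (b j p))"

definition theta ::
    "('a::topological_space, real ^ 'd) atlas \<Rightarrow> 'a endo \<Rightarrow> 'a bilform \<Rightarrow> ('d \<Rightarrow> 'a vfield) \<Rightarrow>
     'a vfield \<Rightarrow> 'a \<Rightarrow> real" where
  "theta A \<phi> g b Z p =
    (\<Sum>i\<in>UNIV. \<Sum>j\<in>UNIV. inverse_gram g b p $ i $ j * fundamental_F A \<phi> g (b i) (b j) Z p)"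

definition theta_star ::
    "('a::topological_space, real ^ 'd) atlas \<Rightarrow> 'a endo \<Rightarrow> 'a bilform \<Rightarrow> ('d \<Rightarrow> 'a vfield) \<Rightarrow>
     'a vfield \<Rightarrow> 'a \<Rightarrow> real" where
  "theta_star A \<phi> g b Z p =
    (\<Sum>i\<in>UNIV. \<Sum>j\<in>UNIV. inverse_gram g b p $ i $ j *
       fundamental_F A \<phi> g (b i) (endo_apply \<phi> (b j)) Z p)"

definition class_F6 ::
    "('a::{t2_space, second_countable_topology}, real ^ 'd) atlas \<Rightarrow>
     'a endo \<Rightarrow> 'a vfield \<Rightarrow> 'a oneform \<Rightarrow> 'a bilform \<Rightarrow> bool" where
  "class_F6 A \<phi> \<xi> \<eta> g \<longleftrightarrow>
    almost_contact_B_metric_manifold A \<phi> \<xi> \<eta> g \<and>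
    (let F = fundamental_F A \<phi> g; VF = smooth_vfields A in
      (\<forall>X\<in>VF. \<forall>Y\<in>VF. \<forall>Z\<in>VF. \<forall>p.
         F X Y Z p = \<eta> p (Y p) * F X Z \<xi> p + \<eta> p (Z p) * F X Y \<xi> p) \<and>
      (\<forall>Y\<in>VF. \<forall>Z\<in>VF. \<forall>p. F \<xi> Y Z p = 0) \<and>
      (\<forall>X\<in>VF. \<forall>Y\<in>VF. \<forall>p. F X Y \<xi> p = F Y X \<xi> p \<and>
         F X Y \<xi> p = - F (endo_apply \<phi> X) (endo_apply \<phi> Y) \<xi> p) \<and>
      (\<forall>p b. adapted_basis_at A \<xi> b p \<longrightarrow>
         (\<forall>Z\<in>VF. theta A \<phi> g b Z p = 0 \<and> theta_star A \<phi> g b Z p = 0)))"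

end

theory Submission
  imports Defs
begin

text \<open>The frame \<open>e\<^sub>i\<close> consists of smooth fields that are orthonormal at every point, hence is a basis
  of every tangent space, and by Cramer's rule smooth vector fields have smooth coefficients in it.
  The brackets of the frame have constant coefficients, so Koszul's formula gives constants
  \<open>\<Gamma>\<close> whose connection is torsion free and metric; by uniqueness it is the Levi-Civita connection.
  Therefore \<open>F\<close> is a tensor with constant components, and these turn out to be
  \<open>F(x, y, z) = \<eta>(y) S(x, z) + \<eta>(z) S(x, y)\<close> for a symmetric trace-free \<open>S\<close> with
  \<open>S(\<xi>, \<cdot>) = 0\<close>, \<open>S(\<phi>x, \<phi>y) = - S(x, y)\<close> and trace-free \<open>S(\<cdot>, \<phi>\<cdot>)\<close>, which is the
  condition for the class F6.\<close>

section \<open>Calculus of \<open>C\<^sup>k\<close> maps\<close>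

text \<open>Let D be the map [., \<xi>] on the span of \<open>e 1\<close>, ..., \<open>e 4\<close>.
  The table of brackets says that D commutes with \<phi> and is trace-free as a complex map for the
  complex structure \<phi>, so D and \<phi> D have real trace 0. As that span is abelian, Koszul's
  formula gives \<open>\<nabla>_x \<xi> = D_s x\<close> and
  \<open>\<nabla>_\<xi> x = - D_a x\<close>, where \<open>D_s\<close> and \<open>D_a\<close> are the
  parts of D symmetric and skew for g. Since \<phi> is self-adjoint, both parts commute with it as
  well. Hence \<open>S(x, y) = - g(\<phi> (D_s x), y)\<close>, and the properties of S come from
  self-adjointness, commutation and the two vanishing traces. The definitions dictate the
  groundwork. Tangent vectors are velocities of curves, seen as operators on functions, so their
  vector space structure and dimension must be taken from charts. \<open>levi_civita\<close> is a
  definite description, so nothing can be read off it before a connection is exhibited and shown to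
  be unique. The traces run over arbitrary fields that form a basis at one point only, hence need a
  change of basis.\<close>

lemma Ck_on_cong:
  assumes "open S" "\<And>x. x \<in> S \<Longrightarrow> f x = g x" "Ck_on k f S"
  shows "Ck_on k g S"
  using assms(2,3)
proof (induction k arbitrary: f g)
  case 0
  then show ?case using continuous_on_cong by force
next
  case (Suc k)
  have d: "f differentiable (at x)" if "x \<in> S" for x
    using Suc.prems that by simp
  have eq: "frechet_derivative f (at x) = frechet_derivative g (at x)" if "x \<in> S" for x
    using frechet_derivative_transform_within_open[OF d[OF that] assms(1) that] Suc.prems(1) by blast
  have "g differentiable (at x)" if "x \<in> S" for x
    using d[OF that] has_derivative_transform_within_open[OF _ assms(1) that] Suc.prems(1)
    unfolding differentiable_def by blast
  moreover have "Ck_on k (\<lambda>x. frechet_derivative g (at x) v) S" for v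
    by (rule Suc.IH[of "\<lambda>x. frechet_derivative f (at x) v"]) (use Suc.prems eq in auto)
  ultimately show ?case by simp
qed

text \<open>\<open>Ck_on\<close> refers to \<open>frechet_derivative\<close>, which is a choice;
  since derivatives are unique, any explicit derivative may stand in for it. All inductions over the
  order go through this rule.\<close>

lemma Ck_on_SucI:
  assumes "open S" and D: "\<And>x. x \<in> S \<Longrightarrow> (f has_derivative f' x) (at x)"
    and C: "\<And>v. Ck_on k (\<lambda>x. f' x v) S"
  shows "Ck_on (Suc k) f S"
proof -
  have "Ck_on k (\<lambda>x. frechet_derivative f (at x) v) S" for v
    by (rule Ck_on_cong[OF assms(1) _ C[of v]]) (simp add: frechet_derivative_at[OF D, symmetric])
  then show ?thesis using D unfolding Ck_on.simps differentiable_def by blast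
qed

lemma Ck_on_SucD:
  assumes "Ck_on (Suc k) f S"
  shows "x \<in> S \<Longrightarrow> (f has_derivative frechet_derivative f (at x)) (at x)"
    and "Ck_on k (\<lambda>x. frechet_derivative f (at x) v) S"
  using assms by (auto simp: frechet_derivative_works[symmetric])

lemma Ck_on_subset: "Ck_on k f S \<Longrightarrow> T \<subseteq> S \<Longrightarrow> Ck_on k f T"
  by (induction k arbitrary: f) (auto intro: continuous_on_subset)

text \<open>The derivative of a product or of a reciprocal still contains undifferentiated factors,
  so those inductions need them at the lower order too.\<close>

lemma Ck_on_lower: "Ck_on (Suc k) f S \<Longrightarrow> Ck_on k f S"
proof (induction k arbitrary: f)
  case 0
  then show ?case
    by (auto intro!: continuous_at_imp_continuous_on differentiable_imp_continuous_within)
next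
  case (Suc k)
  then show ?case unfolding Ck_on.simps(2)[of "Suc k"] Ck_on.simps(2)[of k f] by blast
qed

lemma Ck_on_UN:
  "(\<And>i. i \<in> I \<Longrightarrow> open (S i)) \<Longrightarrow> (\<And>i. i \<in> I \<Longrightarrow> Ck_on k f (S i)) \<Longrightarrow> Ck_on k f (\<Union>i\<in>I. S i)"
  by (induction k arbitrary: f) (auto intro: continuous_on_open_UN)

lemma Ck_on_const: "open S \<Longrightarrow> Ck_on k (\<lambda>x. c) S"
proof (induction k arbitrary: c)
  case (Suc k)
  show ?case by (rule Ck_on_SucI[where f'="\<lambda>x v. 0"]) (use Suc in auto)
qed simp

lemma Ck_on_bounded_linear:
  assumes "open S" "bounded_linear L" "Ck_on k f S"
  shows "Ck_on k (\<lambda>x. L (f x)) S"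
  using assms(3)
proof (induction k arbitrary: f)
  case 0
  then show ?case using bounded_linear.continuous_on[OF assms(2)] by simp
next
  case (Suc k)
  show ?case
    by (rule Ck_on_SucI[OF assms(1) bounded_linear.has_derivative[OF assms(2) Ck_on_SucD(1)[OF Suc.prems]]])
      (auto intro!: Suc.IH Ck_on_SucD(2)[OF Suc.prems])
qed

lemma Ck_on_add:
  assumes "open S" "Ck_on k f S" "Ck_on k g S"
  shows "Ck_on k (\<lambda>x. f x + g x) S"
  using assms(2,3)
proof (induction k arbitrary: f g)
  case 0
  then show ?case by (auto intro: continuous_intros)
next
  case (Suc k)
  show ?case
    by (rule Ck_on_SucI[OF assms(1) has_derivative_add[OF Ck_on_SucD(1)[OF Suc.prems(1)] Ck_on_SucD(1)[OF Suc.prems(2)]]])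
      (auto intro!: Suc.IH Ck_on_SucD(2)[OF Suc.prems(1)] Ck_on_SucD(2)[OF Suc.prems(2)])
qed

lemma Ck_on_mult:
  fixes f g :: "'a::real_normed_vector \<Rightarrow> real"
  assumes "open S" "Ck_on k f S" "Ck_on k g S"
  shows "Ck_on k (\<lambda>x. f x * g x) S"
  using assms(2,3)
proof (induction k arbitrary: f g)
  case 0
  then show ?case by (auto intro: continuous_intros)
next
  case (Suc k)
  show ?case
    by (rule Ck_on_SucI[OF assms(1) has_derivative_mult[OF Ck_on_SucD(1)[OF Suc.prems(1)] Ck_on_SucD(1)[OF Suc.prems(2)]]])
      (auto intro!: Ck_on_add assms(1) Suc.IH Ck_on_SucD(2)[OF Suc.prems(1)] Ck_on_SucD(2)[OF Suc.prems(2)]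
        Ck_on_lower[OF Suc.prems(1)] Ck_on_lower[OF Suc.prems(2)])
qed

text \<open>The derivative of 1/f is -(1/f) f' (1/f), which consists of f' and 1/f itself; the
  induction hypothesis about 1/f at order \<open>k\<close> therefore yields order
  \<open>Suc k\<close>.\<close>

lemma Ck_on_inverse:
  fixes f :: "'a::real_normed_vector \<Rightarrow> real"
  assumes "open S" "\<And>x. x \<in> S \<Longrightarrow> f x \<noteq> 0" "Ck_on k f S"
  shows "Ck_on k (\<lambda>x. inverse (f x)) S"
  using assms(3)
proof (induction k)
  case 0
  then show ?case using assms(2) by (auto intro: continuous_intros)
next
  case (Suc k)
  have inv: "Ck_on k (\<lambda>x. inverse (f x)) S"
    using Suc by (blast intro: Ck_on_lower)
  have neg: "Ck_on k (\<lambda>x. - (inverse (f x) * h x * inverse (f x))) S" if "Ck_on k h S" for h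
    using Ck_on_bounded_linear[OF assms(1) bounded_linear_minus[OF bounded_linear_ident]
        Ck_on_mult[OF assms(1) Ck_on_mult[OF assms(1) inv that] inv]] .
  show ?case
    by (rule Ck_on_SucI[OF assms(1) Deriv.has_derivative_inverse[OF assms(2) Ck_on_SucD(1)[OF Suc.prems]]])
      (auto intro!: neg Ck_on_SucD(2)[OF Suc.prems])
qed

text \<open>Along a line the inner derivative is the constant \<open>w\<close>, so the derivative of
  the composite is again a function composed with the same line and the induction closes. This is
  the chain rule needed to see that straight lines in a chart are smooth curves.\<close>

lemma Ck_on_affine_line:
  fixes S :: "real set"
  assumes "open S" "\<And>t. t \<in> S \<Longrightarrow> x + t *\<^sub>R w \<in> T" "Ck_on k f T"
  shows "Ck_on k (\<lambda>t. f (x + t *\<^sub>R w)) S"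
  using assms(3)
proof (induction k arbitrary: f)
  case 0
  have "continuous_on S (\<lambda>t. x + t *\<^sub>R w)" by (intro continuous_intros)
  then show ?case
    using continuous_on_compose2[of T f S "\<lambda>t. x + t *\<^sub>R w"] 0 assms(2) by auto
next
  case (Suc k)
  have "((\<lambda>t. f (x + t *\<^sub>R w)) has_derivative (\<lambda>s. frechet_derivative f (at (x + t *\<^sub>R w)) (s *\<^sub>R w))) (at t)"
    if "t \<in> S" for t
  proof -
    have "((\<lambda>t. x + t *\<^sub>R w) has_derivative (\<lambda>s. s *\<^sub>R w)) (at t)"
      by (auto intro!: derivative_eq_intros)
    from has_derivative_compose[where g=f, OF this Ck_on_SucD(1)[OF Suc.prems assms(2)[OF that]]]
    show ?thesis .
  qed
  then show ?case
    by (rule Ck_on_SucI[OF assms(1)]) (auto intro!: Suc.IH Ck_on_SucD(2)[OF Suc.prems])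
qed

lemma Cinf_on_differentiable: "Cinf_on f S \<Longrightarrow> x \<in> S \<Longrightarrow> f differentiable (at x)"
  unfolding Cinf_on_def using Ck_on.simps(2) by blast

section \<open>Smooth functions and tangent spaces of a manifold\<close>

locale smooth_mfd =
  fixes A :: "('a::{t2_space, second_countable_topology}, 'e::euclidean_space) atlas"
  assumes smooth: "smooth_manifold A"
begin

section \<open>Charts and their inverses\<close>

lemma
  assumes "(U, c) \<in> A"
  shows chart_open: "open U"
    and chart_range_open: "open (c ` U)"
    and chart_homeo: "homeomorphism U (c ` U) c (inv_into U c)"
proof -
  have "\<forall>(U, c)\<in>A. open U \<and> open (c ` U) \<and> homeomorphism U (c ` U) c (inv_into U c)"
    using smooth unfolding smooth_manifold_def by (elim conjE)
  from bspec[OF this assms]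
  show "open U" "open (c ` U)" "homeomorphism U (c ` U) c (inv_into U c)" by simp_all
qed

lemma chart_transition:
  assumes "(U, c) \<in> A" "(V, d) \<in> A"
  shows "Cinf_on (d \<circ> inv_into U c) (c ` (U \<inter> V))"
proof -
  have "\<forall>(U, c)\<in>A. \<forall>(V, d)\<in>A. Cinf_on (d \<circ> inv_into U c) (c ` (U \<inter> V))"
    using smooth unfolding smooth_manifold_def by (elim conjE)
  from bspec[OF this assms(1), simplified, rule_format, OF assms(2)] show ?thesis by simp
qed

lemma chart_exists: obtains U c where "(U, c) \<in> A" "p \<in> U"
proof -
  have "p \<in> (\<Union>(U, c)\<in>A. U)"
    using smooth unfolding smooth_manifold_def by simp
  then show thesis using that by auto
qed

lemma chart_inv: "(U, c) \<in> A \<Longrightarrow> x \<in> U \<Longrightarrow> inv_into U c (c x) = x"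
  by (rule homeomorphism_apply1[OF chart_homeo])

lemma chart_continuous: "(U, c) \<in> A \<Longrightarrow> continuous_on U c"
  and chart_inv_continuous: "(U, c) \<in> A \<Longrightarrow> continuous_on (c ` U) (inv_into U c)"
  by (simp_all add: homeomorphism_cont1[OF chart_homeo] homeomorphism_cont2[OF chart_homeo])

lemma chart_image_open:
  assumes "(U, c) \<in> A" "open W"
  shows "open (c ` (U \<inter> W))"
proof -
  have "c ` (U \<inter> W) = c ` U \<inter> inv_into U c -` W"
    using chart_inv[OF assms(1)] by auto
  then show ?thesis
    using continuous_open_preimage[OF chart_inv_continuous[OF assms(1)] chart_range_open[OF assms(1)] assms(2)]
    by simp
qed

section \<open>Closure properties and locality of smooth functions\<close>

lemma smooth_fun_on_iff:
  "smooth_fun_on A W f \<longleftrightarrow> continuous_on W f \<and>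
     (\<forall>U c. (U, c) \<in> A \<longrightarrow> (\<forall>k. Ck_on k (\<lambda>x. f (inv_into U c x)) (c ` (U \<inter> W))))"
  unfolding smooth_map_on_def euclidean_atlas_def Cinf_on_def
  by (simp add: o_def Ball_def)

lemma smooth_fun_onI:
  assumes "continuous_on W f"
    and "\<And>U c k. (U, c) \<in> A \<Longrightarrow> Ck_on k (\<lambda>x. f (inv_into U c x)) (c ` (U \<inter> W))"
  shows "smooth_fun_on A W f"
  using assms unfolding smooth_fun_on_iff by simp

lemma smooth_fun_onD:
  assumes "smooth_fun_on A W f"
  shows "continuous_on W f"
    and "(U, c) \<in> A \<Longrightarrow> Ck_on k (\<lambda>x. f (inv_into U c x)) (c ` (U \<inter> W))"
  using assms unfolding smooth_fun_on_iff by simp_all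

lemma smooth_fun_on_subset:
  assumes "smooth_fun_on A W f" "V \<subseteq> W"
  shows "smooth_fun_on A V f"
  by (rule smooth_fun_onI)
    (use assms in \<open>auto intro: continuous_on_subset[OF smooth_fun_onD(1)[OF assms(1)]]
       Ck_on_subset[OF smooth_fun_onD(2)[OF assms(1)]]\<close>)

lemma smooth_fun_on_const: "open W \<Longrightarrow> smooth_fun_on A W (\<lambda>q. a)"
  by (rule smooth_fun_onI) (simp_all add: Ck_on_const chart_image_open)

lemma smooth_fun_on_add:
  assumes "open W" "smooth_fun_on A W f" "smooth_fun_on A W g"
  shows "smooth_fun_on A W (\<lambda>q. f q + g q)"
  by (rule smooth_fun_onI)
    (simp_all add: Ck_on_add chart_image_open continuous_on_add assms(1)
      smooth_fun_onD[OF assms(2)] smooth_fun_onD[OF assms(3)])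

lemma smooth_fun_on_mult:
  assumes "open W" "smooth_fun_on A W f" "smooth_fun_on A W g"
  shows "smooth_fun_on A W (\<lambda>q. f q * g q)"
  by (rule smooth_fun_onI)
    (simp_all add: Ck_on_mult chart_image_open continuous_on_mult assms(1)
      smooth_fun_onD[OF assms(2)] smooth_fun_onD[OF assms(3)])

lemma smooth_fun_on_inverse:
  assumes "open W" "\<And>q. q \<in> W \<Longrightarrow> f q \<noteq> 0" "smooth_fun_on A W f"
  shows "smooth_fun_on A W (\<lambda>q. inverse (f q))"
proof (rule smooth_fun_onI)
  show "continuous_on W (\<lambda>q. inverse (f q))"
    using assms(2) by (intro continuous_on_inverse smooth_fun_onD(1)[OF assms(3)]) simp
  show "Ck_on k (\<lambda>x. inverse (f (inv_into U c x))) (c ` (U \<inter> W))" if "(U, c) \<in> A" for U c k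
  proof (rule Ck_on_inverse[OF chart_image_open[OF that assms(1)] _ smooth_fun_onD(2)[OF assms(3) that]])
    show "f (inv_into U c x) \<noteq> 0" if "x \<in> c ` (U \<inter> W)" for x
      using that assms(2) chart_inv[OF \<open>(U, c) \<in> A\<close>] by auto
  qed
qed

lemma smooth_fun_on_sum:
  "open W \<Longrightarrow> (\<And>i. i \<in> I \<Longrightarrow> smooth_fun_on A W (f i)) \<Longrightarrow> smooth_fun_on A W (\<lambda>q. \<Sum>i\<in>I. f i q)"
  by (induction I rule: infinite_finite_induct) (simp_all add: smooth_fun_on_const smooth_fun_on_add)

lemma smooth_fun_on_prod:
  "open W \<Longrightarrow> (\<And>i. i \<in> I \<Longrightarrow> smooth_fun_on A W (f i)) \<Longrightarrow> smooth_fun_on A W (\<lambda>q. \<Prod>i\<in>I. f i q)"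
  by (induction I rule: infinite_finite_induct) (simp_all add: smooth_fun_on_const smooth_fun_on_mult)

text \<open>The determinant is a polynomial in the entries; this supplies the numerator and the
  denominator in Cramer's rule.\<close>

lemma smooth_fun_on_det:
  fixes M :: "'a \<Rightarrow> real ^ 'n ^ 'n"
  assumes "open W" "\<And>i j. smooth_fun_on A W (\<lambda>q. M q $ i $ j)"
  shows "smooth_fun_on A W (\<lambda>q. det (M q))"
  unfolding det_def
  by (intro smooth_fun_on_sum smooth_fun_on_mult smooth_fun_on_prod smooth_fun_on_const assms)

lemma smooth_fun_on_cong:
  assumes "open W" "\<And>q. q \<in> W \<Longrightarrow> f q = g q" "smooth_fun_on A W f"
  shows "smooth_fun_on A W g"
proof (rule smooth_fun_onI)
  show "continuous_on W g"
    using smooth_fun_onD(1)[OF assms(3)] by (simp add: continuous_on_cong[OF refl assms(2)])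
  show "Ck_on k (\<lambda>x. g (inv_into U c x)) (c ` (U \<inter> W))" if "(U, c) \<in> A" for U c k
  proof (rule Ck_on_cong[OF _ _ smooth_fun_onD(2)[OF assms(3) that]])
    show "open (c ` (U \<inter> W))" by (rule chart_image_open[OF that assms(1)])
    show "f (inv_into U c x) = g (inv_into U c x)" if "x \<in> c ` (U \<inter> W)" for x
      using that assms(2) chart_inv[OF \<open>(U, c) \<in> A\<close>] by auto
  qed
qed

lemma smooth_fun_on_local:
  assumes "\<And>p. p \<in> W \<Longrightarrow> \<exists>N. open N \<and> p \<in> N \<and> smooth_fun_on A N f"
  shows "smooth_fun_on A W f"
proof -
  obtain N where N: "\<And>p. p \<in> W \<Longrightarrow> open (N p)" "\<And>p. p \<in> W \<Longrightarrow> p \<in> N p"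
      "\<And>p. p \<in> W \<Longrightarrow> smooth_fun_on A (N p) f"
    using assms by metis
  show ?thesis
  proof (rule smooth_fun_onI)
    have "continuous_on (\<Union>p\<in>W. N p) f"
      by (intro continuous_on_open_UN N(1) smooth_fun_onD(1) N(3))
    then show "continuous_on W f"
      by (rule continuous_on_subset) (use N(2) in auto)
    show "Ck_on k (\<lambda>x. f (inv_into U c x)) (c ` (U \<inter> W))" if "(U, c) \<in> A" for U c k
    proof (rule Ck_on_subset)
      show "Ck_on k (\<lambda>x. f (inv_into U c x)) (\<Union>p\<in>W. c ` (U \<inter> N p))"
        by (intro Ck_on_UN chart_image_open smooth_fun_onD(2) N(1,3) that)
      show "c ` (U \<inter> W) \<subseteq> (\<Union>p\<in>W. c ` (U \<inter> N p))"
        using N(2) by blast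
    qed
  qed
qed

text \<open>Read in another chart, a coordinate function is a component of the transition map, so
  this is the compatibility of the atlas.\<close>

lemma smooth_fun_on_coordinate:
  assumes "(U, c) \<in> A"
  shows "smooth_fun_on A U (\<lambda>q. c q \<bullet> b)"
proof (rule smooth_fun_onI)
  show "continuous_on U (\<lambda>q. c q \<bullet> b)"
    by (intro continuous_on_inner chart_continuous[OF assms] continuous_on_const)
  show "Ck_on k (\<lambda>x. c (inv_into V d x) \<bullet> b) (d ` (V \<inter> U))" if "(V, d) \<in> A" for V d k
    by (rule Ck_on_bounded_linear[OF chart_image_open[OF that chart_open[OF assms]] bounded_linear_inner_left])
      (use chart_transition[OF that assms] in \<open>simp add: Cinf_on_def o_def\<close>)
qed

section \<open>Functions smooth near a point\<close>

lemma smooth_nearI: "open W \<Longrightarrow> p \<in> W \<Longrightarrow> smooth_fun_on A W f \<Longrightarrow> smooth_near A p f"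
  unfolding smooth_near_def by blast

lemma smooth_near2:
  assumes "smooth_near A p f" "smooth_near A p g"
  obtains W where "open W" "p \<in> W" "smooth_fun_on A W f" "smooth_fun_on A W g"
proof -
  obtain V V' where V: "open V" "p \<in> V" "smooth_fun_on A V f" "open V'" "p \<in> V'" "smooth_fun_on A V' g"
    using assms unfolding smooth_near_def by (elim exE conjE)
  show thesis
  proof (rule that)
    show "open (V \<inter> V')" "p \<in> V \<inter> V'" using V by auto
    show "smooth_fun_on A (V \<inter> V') f" "smooth_fun_on A (V \<inter> V') g"
      using smooth_fun_on_subset[OF V(3)] smooth_fun_on_subset[OF V(6)] by simp_all
  qed
qed

lemma smooth_near_const: "smooth_near A p (\<lambda>q. a)"
  by (rule smooth_nearI[of UNIV]) (simp_all add: smooth_fun_on_const)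

lemma smooth_near_add:
  assumes "smooth_near A p f" "smooth_near A p g"
  shows "smooth_near A p (\<lambda>q. f q + g q)"
proof -
  obtain W where "open W" "p \<in> W" "smooth_fun_on A W f" "smooth_fun_on A W g"
    by (rule smooth_near2[OF assms])
  then show ?thesis by (intro smooth_nearI smooth_fun_on_add)
qed

lemma smooth_near_mult:
  assumes "smooth_near A p f" "smooth_near A p g"
  shows "smooth_near A p (\<lambda>q. f q * g q)"
proof -
  obtain W where "open W" "p \<in> W" "smooth_fun_on A W f" "smooth_fun_on A W g"
    by (rule smooth_near2[OF assms])
  then show ?thesis by (intro smooth_nearI smooth_fun_on_mult)
qed

lemma smooth_near_sum:
  "(\<And>i. i \<in> I \<Longrightarrow> smooth_near A p (f i)) \<Longrightarrow> smooth_near A p (\<lambda>q. \<Sum>i\<in>I. f i q)"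
  by (induction I rule: infinite_finite_induct) (simp_all add: smooth_near_const smooth_near_add)

lemma smooth_near_differentiable:
  assumes "smooth_near A p f" "(U, c) \<in> A" "p \<in> U"
  shows "(\<lambda>x. f (inv_into U c x)) differentiable (at (c p))"
proof -
  obtain W where W: "open W" "p \<in> W" "smooth_fun_on A W f"
    using assms(1) unfolding smooth_near_def by (elim exE conjE)
  have "c p \<in> c ` (U \<inter> W)" using W(2) assms(3) by (intro imageI IntI)
  moreover have "Ck_on (Suc 0) (\<lambda>x. f (inv_into U c x)) (c ` (U \<inter> W))"
    by (rule smooth_fun_onD(2)[OF W(3) assms(2)])
  ultimately show ?thesis unfolding Ck_on.simps by (elim conjE) (rule bspec)
qed

text \<open>The directional derivative along \<open>w\<close> in the chart. The value 0 on functions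
  that are not smooth near \<open>p\<close> copies the convention of \<open>velocity\<close>, so
  that the two can be equal as operators and not only on smooth functions.\<close>

definition chart_vector :: "'a set \<Rightarrow> ('a \<Rightarrow> 'e) \<Rightarrow> 'a \<Rightarrow> 'e \<Rightarrow> 'a tvec" where
  "chart_vector U c p w =
     (\<lambda>f. if smooth_near A p f then frechet_derivative (\<lambda>x. f (inv_into U c x)) (at (c p)) w else 0)"

lemma linear_chart_vector:
  assumes "(U, c) \<in> A" "p \<in> U"
  shows "linear (chart_vector U c p)"
proof -
  have lin: "linear (frechet_derivative (\<lambda>x. f (inv_into U c x)) (at (c p)))" if "smooth_near A p f" for f
    using linear_frechet_derivative[OF smooth_near_differentiable[OF that assms]] .
  show ?thesis
    by (rule linearI)
      (auto simp: fun_eq_iff chart_vector_def scaleR_fun_def linear_add[OF lin] linear_scale[OF lin])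
qed

lemma chart_vector_coordinate:
  assumes "(U, c) \<in> A" "p \<in> U"
  shows "chart_vector U c p w (\<lambda>q. c q \<bullet> b) = w \<bullet> b"
proof -
  have "((\<lambda>x. c (inv_into U c x) \<bullet> b) has_derivative (\<lambda>x. x \<bullet> b)) (at (c p))"
    by (rule has_derivative_transform_within_open[of "\<lambda>x. x \<bullet> b" _ _ _ "c ` U"])
      (use assms chart_range_open in \<open>auto simp: chart_inv intro!: derivative_eq_intros\<close>)
  from frechet_derivative_at[OF this]
  have "frechet_derivative (\<lambda>x. c (inv_into U c x) \<bullet> b) (at (c p)) = (\<lambda>x. x \<bullet> b)" ..
  moreover have "smooth_near A p (\<lambda>q. c q \<bullet> b)"
    by (rule smooth_nearI[OF chart_open[OF assms(1)] assms(2) smooth_fun_on_coordinate[OF assms(1)]])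
  ultimately show ?thesis by (simp add: chart_vector_def)
qed

lemma inj_chart_vector:
  assumes "(U, c) \<in> A" "p \<in> U"
  shows "inj (chart_vector U c p)"
proof (rule injI)
  fix v w
  assume eq: "chart_vector U c p v = chart_vector U c p w"
  show "v = w"
  proof (rule euclidean_eqI)
    show "v \<bullet> b = w \<bullet> b" for b
      using chart_vector_coordinate[OF assms, of v b] chart_vector_coordinate[OF assms, of w b] eq by simp
  qed
qed

lemma smooth_map_on_interval_iff:
  "smooth_map_on euclidean_atlas A I \<gamma> \<longleftrightarrow>
     continuous_on I \<gamma> \<and> (\<forall>(V, d)\<in>A. Cinf_on (\<lambda>t. d (\<gamma> t)) (I \<inter> \<gamma> -` V))"
proof -
  have "d \<circ> \<gamma> \<circ> inv_into UNIV id = (\<lambda>t. d (\<gamma> t))" for d :: "'a \<Rightarrow> 'e"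
    by (simp add: fun_eq_iff)
  then show ?thesis
    unfolding smooth_map_on_def euclidean_atlas_def by simp
qed

lemma curve_chart_differentiable:
  assumes "smooth_curve A \<gamma>" "(U, c) \<in> A" "\<gamma> 0 \<in> U"
  obtains S where "open S" "0 \<in> S" "\<gamma> ` S \<subseteq> U" "(\<lambda>t. c (\<gamma> t)) differentiable (at 0)"
proof -
  obtain \<epsilon> where \<epsilon>: "\<epsilon> > 0" "smooth_map_on euclidean_atlas A {-\<epsilon><..<\<epsilon>} \<gamma>"
    using assms(1) unfolding smooth_curve_def by blast
  define S where "S = {-\<epsilon><..<\<epsilon>} \<inter> \<gamma> -` U"
  have "Cinf_on (\<lambda>t. c (\<gamma> t)) S"
    using bspec[OF conjunct2[OF \<epsilon>(2)[unfolded smooth_map_on_interval_iff]] assms(2)] by (simp add: S_def)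
  moreover have cont: "continuous_on {-\<epsilon><..<\<epsilon>} \<gamma>"
    using \<epsilon>(2) unfolding smooth_map_on_interval_iff by (rule conjunct1)
  moreover have "0 \<in> S" using \<epsilon> assms(3) by (auto simp: S_def)
  moreover have "open S"
    unfolding S_def by (rule continuous_open_preimage[OF cont _ chart_open[OF assms(2)]]) simp
  moreover have "\<gamma> ` S \<subseteq> U" by (auto simp: S_def)
  ultimately show thesis
    using that[of S] Cinf_on_differentiable[of "\<lambda>t. c (\<gamma> t)" S 0] by simp
qed

text \<open>Chain rule for f \<circ> \<gamma> as the composite of f in the chart with the chart
  image of \<gamma>. The factorization holds only while \<gamma> stays in \<open>U\<close>, which an
  open set of times around 0 guarantees.\<close>

lemma velocity_eq_chart_vector:
  assumes "smooth_curve A \<gamma>" "(U, c) \<in> A" "\<gamma> 0 \<in> U"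
    and D: "((\<lambda>t. c (\<gamma> t)) has_vector_derivative w) (at 0)"
  shows "velocity A \<gamma> = chart_vector U c (\<gamma> 0) w"
proof -
  obtain S where S: "open S" "0 \<in> S" "\<gamma> ` S \<subseteq> U"
    using curve_chart_differentiable[OF assms(1-3)] .
  have "deriv (\<lambda>t. f (\<gamma> t)) 0 = frechet_derivative (\<lambda>x. f (inv_into U c x)) (at (c (\<gamma> 0))) w"
    if "smooth_near A (\<gamma> 0) f" for f
  proof -
    let ?D = "frechet_derivative (\<lambda>x. f (inv_into U c x)) (at (c (\<gamma> 0)))"
    have diff: "(\<lambda>x. f (inv_into U c x)) differentiable (at (c (\<gamma> 0)))"
      by (rule smooth_near_differentiable[OF that assms(2,3)])
    then have D': "((\<lambda>x. f (inv_into U c x)) has_derivative ?D) (at (c (\<gamma> 0)))"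
      by (simp add: frechet_derivative_works)
    have "((\<lambda>t. f (inv_into U c (c (\<gamma> t)))) has_derivative (\<lambda>t. ?D (t *\<^sub>R w))) (at 0)"
      using has_derivative_compose[OF D[unfolded has_vector_derivative_def] D'] .
    then have "((\<lambda>t. f (\<gamma> t)) has_derivative (\<lambda>t. ?D (t *\<^sub>R w))) (at 0)"
      by (rule has_derivative_transform_within_open[OF _ S(1,2)])
        (use S(3) chart_inv[OF assms(2)] in auto)
    also have "(\<lambda>t. ?D (t *\<^sub>R w)) = (*) (?D w)"
      by (auto simp: linear_scale[OF linear_frechet_derivative[OF diff]])
    finally have "((\<lambda>t. f (\<gamma> t)) has_field_derivative ?D w) (at 0)"
      unfolding has_field_derivative_def .
    then show ?thesis by (rule DERIV_imp_deriv)
  qed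
  then show ?thesis by (auto simp: velocity_def chart_vector_def fun_eq_iff)
qed

text \<open>Every \<open>w\<close> is the velocity of a smooth curve: pull back the straight line
  through \<open>c p\<close>. Seen from another chart, that curve is a transition map restricted to
  a line.\<close>

lemma chart_line_smooth_curve:
  assumes "(U, c) \<in> A" "p \<in> U"
  shows "smooth_curve A (\<lambda>t. inv_into U c (c p + t *\<^sub>R w))"
    and "((\<lambda>t. c (inv_into U c (c p + t *\<^sub>R w))) has_vector_derivative w) (at 0)"
proof -
  let ?l = "\<lambda>t. c p + t *\<^sub>R w" and ?i = "inv_into U c"
  have cont: "continuous_on X ?l" for X by (intro continuous_intros)
  have "open (?l -` (c ` U))"
    using open_vimage[OF chart_range_open[OF assms(1)] cont] .
  moreover have "0 \<in> ?l -` (c ` U)" using assms by auto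
  \<comment> \<open>The range of the chart is open, so the line stays inside it for short times;
    outside this interval \<open>inv_into\<close> is meaningless.\<close>
  ultimately obtain \<epsilon> where \<epsilon>: "\<epsilon> > 0" "ball 0 \<epsilon> \<subseteq> ?l -` (c ` U)"
    using openE by blast
  let ?I = "{-\<epsilon><..<\<epsilon>}"
  have l: "?l t \<in> c ` U" if "t \<in> ?I" for t
    using \<epsilon>(2) that by (auto simp: subset_iff abs_less_iff)
  have ci: "c (?i (?l t)) = ?l t" if "t \<in> ?I" for t
    using l[OF that] by (rule f_inv_into_f)
  have contI: "continuous_on ?I (\<lambda>t. ?i (?l t))"
    using l by (intro continuous_on_compose2[OF chart_inv_continuous[OF assms(1)] cont]) auto
  have "Cinf_on (\<lambda>t. d (?i (?l t))) (?I \<inter> (\<lambda>t. ?i (?l t)) -` V)" if "(V, d) \<in> A" for V d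
    unfolding Cinf_on_def
  proof (intro allI Ck_on_affine_line)
    show "open (?I \<inter> (\<lambda>t. ?i (?l t)) -` V)"
      by (rule continuous_open_preimage[OF contI _ chart_open[OF that]]) simp
    show "?l t \<in> c ` (U \<inter> V)" if t: "t \<in> ?I \<inter> (\<lambda>t. ?i (?l t)) -` V" for t
    proof (rule image_eqI)
      show "?l t = c (?i (?l t))" using ci[of t] t by simp
      show "?i (?l t) \<in> U \<inter> V" using inv_into_into[OF l[of t]] t by simp
    qed
    show "Ck_on k (\<lambda>x. d (?i x)) (c ` (U \<inter> V))" for k
      using chart_transition[OF assms(1) that] by (simp add: Cinf_on_def o_def)
  qed
  then have "smooth_map_on euclidean_atlas A ?I (\<lambda>t. ?i (?l t))"
    unfolding smooth_map_on_interval_iff using contI by blast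
  with \<epsilon>(1) show "smooth_curve A (\<lambda>t. ?i (?l t))"
    unfolding smooth_curve_def by blast
  have "(?l has_derivative (\<lambda>t. t *\<^sub>R w)) (at 0)"
    by (auto intro!: derivative_eq_intros)
  then show "((\<lambda>t. c (?i (?l t))) has_vector_derivative w) (at 0)"
    unfolding has_vector_derivative_def
    by (rule has_derivative_transform_within_open[of _ _ _ _ ?I]) (use \<epsilon>(1) ci in auto)
qed

text \<open>Curves cannot be added, so linearity of the set of velocities is invisible in its
  definition. One inclusion is the chain rule, the other uses chart lines; together they present the
  tangent space as a linear injective image of the model space.\<close>

lemma tangent_space_eq_range:
  assumes "(U, c) \<in> A" "p \<in> U"
  shows "tangent_space A p = range (chart_vector U c p)"
proof (intro equalityI subsetI)
  fix v
  assume "v \<in> tangent_space A p"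
  then obtain \<gamma> where \<gamma>: "smooth_curve A \<gamma>" "\<gamma> 0 = p" "v = velocity A \<gamma>"
    unfolding tangent_space_def by blast
  then have "\<gamma> 0 \<in> U" using assms(2) by simp
  from curve_chart_differentiable[OF \<gamma>(1) assms(1) this]
  have "((\<lambda>t. c (\<gamma> t)) has_vector_derivative vector_derivative (\<lambda>t. c (\<gamma> t)) (at 0)) (at 0)"
    using vector_derivative_works by blast
  from velocity_eq_chart_vector[OF \<gamma>(1) assms(1) \<open>\<gamma> 0 \<in> U\<close> this]
  show "v \<in> range (chart_vector U c p)" using \<gamma> by auto
next
  fix v
  assume "v \<in> range (chart_vector U c p)"
  then obtain w where w: "v = chart_vector U c p w" by blast
  let ?\<gamma> = "\<lambda>t. inv_into U c (c p + t *\<^sub>R w)"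
  have "?\<gamma> 0 = p" using chart_inv[OF assms] by simp
  moreover have "velocity A ?\<gamma> = chart_vector U c p w"
    using velocity_eq_chart_vector[OF chart_line_smooth_curve(1)[OF assms, of w] assms(1) _ chart_line_smooth_curve(2)[OF assms, of w]]
      assms(2) calculation by simp
  ultimately have "v = velocity A ?\<gamma> \<and> smooth_curve A ?\<gamma> \<and> ?\<gamma> 0 = p"
    using chart_line_smooth_curve(1)[OF assms, of w] w by simp
  then show "v \<in> tangent_space A p"
    unfolding tangent_space_def by blast
qed

lemma subspace_tangent_space: "subspace (tangent_space A p)"
proof -
  obtain U c where c: "(U, c) \<in> A" "p \<in> U" by (rule chart_exists)
  show ?thesis
    unfolding tangent_space_eq_range[OF c]
    by (rule linear_subspace_image[OF linear_chart_vector[OF c] subspace_UNIV])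
qed

text \<open>\<open>chart_vector\<close> is linear and injective, so \<open>B\<close> comes from an
  independent set of the same size in the model space, where the dimension count forces it to
  span.\<close>

lemma span_eq_tangent_space:
  assumes "independent B" "B \<subseteq> tangent_space A p" "card B = DIM('e)"
  shows "span B = tangent_space A p"
proof -
  obtain U c where c: "(U, c) \<in> A" "p \<in> U" by (rule chart_exists)
  let ?T = "chart_vector U c p"
  obtain B' where B': "B = ?T ` B'"
    using assms(2) unfolding tangent_space_eq_range[OF c] subset_image_iff by blast
  have "independent B'"
    unfolding dependent_def
  proof (intro notI, elim bexE)
    fix a
    assume a: "a \<in> B'" "a \<in> span (B' - {a})"
    then have "?T a \<in> span (?T ` (B' - {a}))"
      using linear_span_image[OF linear_chart_vector[OF c]] by blast
    also have "?T ` (B' - {a}) = B - {?T a}"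
      using inj_chart_vector[OF c] unfolding B' by (auto dest: injD)
    finally show False
      using assms(1) a(1) B' unfolding dependent_def by blast
  qed
  moreover have "card B' = DIM('e)"
    using assms(3) card_image[of ?T B'] inj_chart_vector[OF c] inj_on_subset B' by fastforce
  ultimately have "span B' = UNIV"
    using card_eq_dim[of B' UNIV] by (auto simp: independent_imp_finite dim_UNIV)
  then show ?thesis
    unfolding B' linear_span_image[OF linear_chart_vector[OF c]] tangent_space_eq_range[OF c] by (rule arg_cong)
qed

section \<open>Tangent vectors as derivations\<close>

lemma tangent_vector_chart:
  assumes "v \<in> tangent_space A p"
  obtains U c w where "(U, c) \<in> A" "p \<in> U" "v = chart_vector U c p w"
proof -
  obtain U c where c: "(U, c) \<in> A" "p \<in> U" by (rule chart_exists)
  from assms[unfolded tangent_space_eq_range[OF c]] obtain w where "v = chart_vector U c p w"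
    by (rule rangeE)
  with c show thesis by (rule that)
qed

lemma chart_vector_eq:
  assumes "smooth_near A p f" "((\<lambda>x. f (inv_into U c x)) has_derivative f') (at (c p))"
  shows "chart_vector U c p w f = f' w"
  using assms(1) frechet_derivative_at[OF assms(2)] by (simp add: chart_vector_def)

lemma tangent_not_smooth:
  assumes "v \<in> tangent_space A p" "\<not> smooth_near A p f"
  shows "v f = 0"
proof -
  from assms(1) obtain U c w where "v = chart_vector U c p w" by (rule tangent_vector_chart)
  with assms(2) show ?thesis by (simp add: chart_vector_def)
qed

lemma tangent_const:
  assumes "v \<in> tangent_space A p"
  shows "v (\<lambda>q. a) = 0"
proof -
  from assms(1) obtain U c w where "v = chart_vector U c p w" by (rule tangent_vector_chart)
  with chart_vector_eq[OF smooth_near_const has_derivative_const] show ?thesis by simp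
qed

lemma
  assumes "v \<in> tangent_space A p" and f: "smooth_near A p f" and g: "smooth_near A p g"
  shows tangent_add: "v (\<lambda>q. f q + g q) = v f + v g"
    and tangent_mult: "v (\<lambda>q. f q * g q) = f p * v g + g p * v f"
proof -
  from assms(1) obtain U c w where R: "(U, c) \<in> A" "p \<in> U" "v = chart_vector U c p w"
    by (rule tangent_vector_chart)
  from smooth_near_differentiable[OF f R(1,2)]
  obtain f' where D: "((\<lambda>x. f (inv_into U c x)) has_derivative f') (at (c p))"
    unfolding differentiable_def by (rule exE)
  from smooth_near_differentiable[OF g R(1,2)]
  obtain g' where D': "((\<lambda>x. g (inv_into U c x)) has_derivative g') (at (c p))"
    unfolding differentiable_def by (rule exE)
  show "v (\<lambda>q. f q + g q) = v f + v g"
    unfolding R(3) chart_vector_eq[OF f D] chart_vector_eq[OF g D']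
      chart_vector_eq[OF smooth_near_add[OF f g] has_derivative_add[OF D D']] ..
  show "v (\<lambda>q. f q * g q) = f p * v g + g p * v f"
    unfolding R(3) chart_vector_eq[OF f D] chart_vector_eq[OF g D']
      chart_vector_eq[OF smooth_near_mult[OF f g] has_derivative_mult[OF D D']]
    by (simp add: chart_inv[OF R(1,2)])
qed

lemma tangent_cmult:
  assumes "v \<in> tangent_space A p" "smooth_near A p f"
  shows "v (\<lambda>q. a * f q) = a * v f"
  using tangent_mult[OF assms(1) smooth_near_const assms(2)] tangent_const[OF assms(1)] by simp

lemma tangent_sum:
  assumes "v \<in> tangent_space A p" "\<And>i. i \<in> I \<Longrightarrow> smooth_near A p (f i)"
  shows "v (\<lambda>q. \<Sum>i\<in>I. f i q) = (\<Sum>i\<in>I. v (f i))"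
  using assms(2)
  by (induction I rule: infinite_finite_induct)
    (auto simp: tangent_const[OF assms(1)] tangent_add[OF assms(1)] smooth_near_sum)

end

section \<open>Orthonormal frames\<close>

lemma sum_fun_apply:
  fixes F :: "'i \<Rightarrow> 'x \<Rightarrow> 'y::comm_monoid_add"
  shows "(\<Sum>i\<in>I. F i) x = (\<Sum>i\<in>I. F i x)"
  by (induction I rule: infinite_finite_induct) simp_all

text \<open>Linearity is granted only inside \<open>S\<close>, so the induction has to keep every
  partial sum in \<open>S\<close>.\<close>

lemma linear_on_subspace_sum:
  assumes "linear_on_subspace S f" "subspace S" "\<And>i. i \<in> I \<Longrightarrow> v i \<in> S"
  shows "f (\<Sum>i\<in>I. a i *\<^sub>R v i) = (\<Sum>i\<in>I. a i *\<^sub>R f (v i))"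
proof -
  have zero: "f 0 = 0"
    using assms(1)[unfolded linear_on_subspace_def, rule_format, of 0 0 0 0] subspace_0[OF assms(2)] by simp
  show ?thesis
    using assms(3)
  proof (induction I rule: infinite_finite_induct)
    case (insert i I)
    have "f (a i *\<^sub>R v i + 1 *\<^sub>R (\<Sum>i\<in>I. a i *\<^sub>R v i)) = a i *\<^sub>R f (v i) + 1 *\<^sub>R f (\<Sum>i\<in>I. a i *\<^sub>R v i)"
    proof (rule assms(1)[unfolded linear_on_subspace_def, rule_format])
      show "v i \<in> S" by (simp add: insert.prems)
      show "(\<Sum>i\<in>I. a i *\<^sub>R v i) \<in> S"
        by (intro subspace_sum subspace_scale assms(2)) (simp add: insert.prems)
    qed
    then show ?case using insert by simp
  qed (simp_all add: zero)
qed

context smooth_mfd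
begin

section \<open>Smooth vector fields as a module over the smooth functions\<close>

lemma vfield_tangent: "X \<in> smooth_vfields A \<Longrightarrow> X p \<in> tangent_space A p"
  unfolding smooth_vfields_def by simp

lemma vfield_smooth:
  "X \<in> smooth_vfields A \<Longrightarrow> open W \<Longrightarrow> smooth_fun_on A W f \<Longrightarrow> smooth_fun_on A W (\<lambda>p. X p f)"
  unfolding smooth_vfields_def by simp

lemma vfieldI:
  assumes "\<And>p. X p \<in> tangent_space A p"
    and "\<And>W f. open W \<Longrightarrow> smooth_fun_on A W f \<Longrightarrow> smooth_fun_on A W (\<lambda>p. X p f)"
  shows "X \<in> smooth_vfields A"
  using assms unfolding smooth_vfields_def by simp

lemma vfield_smooth_near:
  assumes "X \<in> smooth_vfields A" "smooth_near A p f"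
  shows "smooth_near A p (\<lambda>q. X q f)"
proof -
  obtain W where W: "open W" "p \<in> W" "smooth_fun_on A W f"
    using assms(2) unfolding smooth_near_def by (elim exE conjE)
  show ?thesis by (rule smooth_nearI[OF W(1,2) vfield_smooth[OF assms(1) W(1,3)]])
qed

lemma smooth_near_of_smooth: "smooth_fun_on A UNIV f \<Longrightarrow> smooth_near A p f"
  by (rule smooth_nearI[of UNIV]) simp_all

lemma vfield_lincomb:
  assumes "\<And>i. i \<in> I \<Longrightarrow> X i \<in> smooth_vfields A" "\<And>i. i \<in> I \<Longrightarrow> smooth_fun_on A UNIV (a i)"
  shows "(\<lambda>p. \<Sum>i\<in>I. a i p *\<^sub>R X i p) \<in> smooth_vfields A"
proof (rule vfieldI)
  show "(\<Sum>i\<in>I. a i p *\<^sub>R X i p) \<in> tangent_space A p" for p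
    by (intro subspace_sum subspace_scale subspace_tangent_space vfield_tangent assms(1))
  show "smooth_fun_on A W (\<lambda>p. (\<Sum>i\<in>I. a i p *\<^sub>R X i p) f)" if W: "open W" "smooth_fun_on A W f" for W f
    unfolding sum_fun_apply scaleR_fun_def real_scaleR_def
    by (intro smooth_fun_on_sum smooth_fun_on_mult W(1) vfield_smooth[OF assms(1) W]
        smooth_fun_on_subset[OF assms(2)]) simp_all
qed

lemma vfield_scale:
  assumes "X \<in> smooth_vfields A" "smooth_fun_on A UNIV f"
  shows "(\<lambda>p. f p *\<^sub>R X p) \<in> smooth_vfields A"
  using vfield_lincomb[of "{()}" "\<lambda>_. X" "\<lambda>_. f"] assms by simp

lemma vfield_add:
  assumes "X \<in> smooth_vfields A" "Y \<in> smooth_vfields A"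
  shows "X + Y \<in> smooth_vfields A"
proof -
  \<comment> \<open>Summing over the two truth values makes the two-term sum an instance of
    \<open>vfield_lincomb\<close>.\<close>
  have "(\<lambda>p. \<Sum>b\<in>UNIV. 1 *\<^sub>R (if b then X else Y) p) \<in> smooth_vfields A"
    by (rule vfield_lincomb) (use assms smooth_fun_on_const in auto)
  also have "(\<lambda>p. \<Sum>b\<in>UNIV. 1 *\<^sub>R (if b then X else Y) p) = X + Y"
    by (simp add: fun_eq_iff UNIV_bool)
  finally show ?thesis .
qed

end

text \<open>The square condition says that each sign is 1 or -1 and leaves the signature open. Of g
  only bilinearity is assumed; symmetry, smoothness and nondegeneracy are derived in
  \<open>frame_metric\<close> from the constant diagonal Gram matrix.\<close>

locale orthonormal_frame = smooth_mfd A
  for A :: "('a::{t2_space, second_countable_topology}, real ^ 'd) atlas" +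
  fixes g :: "'a bilform" and E :: "'d \<Rightarrow> 'a vfield" and \<epsilon> :: "'d \<Rightarrow> real"
  assumes bilform: "bilform_field A g"
    and frame: "E i \<in> smooth_vfields A"
    and ortho: "g p (E i p) (E j p) = (if i = j then \<epsilon> i else 0)"
    and eps: "\<epsilon> i * \<epsilon> i = 1"
begin

abbreviation "VF \<equiv> smooth_vfields A"

text \<open>Pairing with \<open>E k\<close> isolates the \<open>k\<close>-th coefficient up to the
  factor \<open>\<epsilon> k\<close>, which is its own inverse.\<close>

definition coord :: "'d \<Rightarrow> 'a \<Rightarrow> 'a tvec \<Rightarrow> real" where
  "coord k p v = \<epsilon> k * g p v (E k p)"

lemma frame_tangent: "E k p \<in> tangent_space A p"
  by (rule vfield_tangent[OF frame])

lemma lincomb_tangent: "(\<Sum>k\<in>UNIV. a k *\<^sub>R E k p) \<in> tangent_space A p"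
  by (intro subspace_sum subspace_scale subspace_tangent_space frame_tangent)

lemma coord_linear: "linear_on_subspace (tangent_space A p) (coord k p)"
  using bilform frame_tangent[of k p]
  unfolding bilform_field_def linear_on_subspace_def coord_def by (simp add: algebra_simps)

lemma coord_lincomb: "coord k p (\<Sum>i\<in>UNIV. a i *\<^sub>R E i p) = a k"
proof -
  have "coord k p (\<Sum>i\<in>UNIV. a i *\<^sub>R E i p) = (\<Sum>i\<in>UNIV. a i * coord k p (E i p))"
    using linear_on_subspace_sum[OF coord_linear subspace_tangent_space, of UNIV "\<lambda>i. E i p" p k a] frame_tangent
    by simp
  also have "\<dots> = (\<Sum>i\<in>UNIV. if i = k then a k else 0)"
    by (intro sum.cong refl) (simp add: coord_def ortho eps)
  finally show ?thesis by simp
qed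

lemma frame_inj: "inj (\<lambda>i. E i p)"
proof (rule injI, rule ccontr)
  fix i j assume "E i p = E j p" "i \<noteq> j"
  then have "\<epsilon> i = 0" using ortho[of p i j] ortho[of p i i] by simp
  then show False using eps[of i] by simp
qed

lemma frame_independent: "independent (range (\<lambda>i. E i p))"
proof
  assume "dependent (range (\<lambda>i. E i p))"
  then obtain u k where u: "u (E k p) \<noteq> 0" "(\<Sum>v\<in>range (\<lambda>i. E i p). u v *\<^sub>R v) = 0"
    unfolding dependent_finite[OF finite_imageI[OF finite]] by blast
  then have "(\<Sum>i\<in>UNIV. u (E i p) *\<^sub>R E i p) = 0"
    by (simp add: sum.reindex[OF frame_inj])
  then have "u (E k p) = coord k p 0" using coord_lincomb[of k p "\<lambda>i. u (E i p)"] by simp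
  also have "\<dots> = 0" using coord_lincomb[of k p "\<lambda>i. 0"] by simp
  finally show False using u(1) by simp
qed

text \<open>The frame is indexed by the same type as the coordinates of the model space, so it has
  exactly as many members as the dimension and independence suffices.\<close>

lemma frame_span: "span (range (\<lambda>i. E i p)) = tangent_space A p"
  by (rule span_eq_tangent_space[OF frame_independent])
    (auto simp: frame_tangent card_image[OF frame_inj])

lemma expansion:
  assumes "v \<in> tangent_space A p"
  shows "v = (\<Sum>k\<in>UNIV. coord k p v *\<^sub>R E k p)"
proof -
  have "v \<in> range (\<lambda>u. \<Sum>v\<in>range (\<lambda>i. E i p). u v *\<^sub>R v)"
    using assms unfolding frame_span[symmetric] span_finite[OF finite_imageI[OF finite]] .
  then obtain u where "v = (\<Sum>v\<in>range (\<lambda>i. E i p). u v *\<^sub>R v)" by blast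
  then have "v = (\<Sum>i\<in>UNIV. u (E i p) *\<^sub>R E i p)"
    by (simp add: sum.reindex[OF frame_inj])
  then show ?thesis using coord_lincomb[of _ p "\<lambda>i. u (E i p)"] by simp
qed

lemma tangent_apply:
  assumes "v \<in> tangent_space A p"
  shows "v f = (\<Sum>k\<in>UNIV. coord k p v * E k p f)"
  by (subst expansion[OF assms]) (simp add: sum_fun_apply scaleR_fun_def)

lemma tangent_eqI:
  assumes "u \<in> tangent_space A p" "v \<in> tangent_space A p" "\<And>k. coord k p u = coord k p v"
  shows "u = v"
  using expansion[OF assms(1)] expansion[OF assms(2)] assms(3) by simp

lemma metric_expansion:
  assumes "u \<in> tangent_space A p" "v \<in> tangent_space A p"
  shows "g p u v = (\<Sum>k\<in>UNIV. \<epsilon> k * coord k p u * coord k p v)"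
proof -
  have lin: "linear_on_subspace (tangent_space A p) (g p u)"
    using bilform assms(1) unfolding bilform_field_def by simp
  have "g p u (E k p) = \<epsilon> k * coord k p u" for k
    using eps[of k] by (simp add: coord_def mult.assoc[symmetric])
  then have "g p u (\<Sum>k\<in>UNIV. coord k p v *\<^sub>R E k p) = (\<Sum>k\<in>UNIV. \<epsilon> k * coord k p u * coord k p v)"
    using linear_on_subspace_sum[OF lin subspace_tangent_space, of UNIV "\<lambda>i. E i p"] frame_tangent
    by (simp add: mult_ac)
  then show ?thesis using expansion[OF assms(2)] by simp
qed

definition cf :: "'a vfield \<Rightarrow> 'd \<Rightarrow> 'a \<Rightarrow> real" where
  "cf X k = (\<lambda>p. coord k p (X p))"

text \<open>In a chart the coefficients solve the linear system with the coordinate derivatives of the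
  frame as matrix, so that Cramer's rule expresses them by smooth functions.\<close>

lemma cf_smooth:
  assumes "X \<in> VF"
  shows "smooth_fun_on A UNIV (cf X k)"
proof (rule smooth_fun_on_local)
  fix p
  obtain U c where c: "(U, c) \<in> A" "p \<in> U" by (rule chart_exists)
  have U: "open U" by (rule chart_open[OF c(1)])
  define h :: "'d \<Rightarrow> 'a \<Rightarrow> real" where "h i = (\<lambda>q. c q \<bullet> axis i 1)" for i
  define M :: "'a \<Rightarrow> real ^ 'd ^ 'd" where "M q = (\<chi> i j. E j q (h i))" for q
  \<comment> \<open>Cramer's numerator for the \<open>k\<close>-th unknown: column \<open>k\<close>
    is replaced by the right-hand side, the derivatives of the coordinates along
    \<open>X\<close>.\<close>
  define M' :: "'a \<Rightarrow> real ^ 'd ^ 'd" where "M' q = (\<chi> i j. if j = k then X q (h i) else M q $ i $ j)" for q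
  have h: "smooth_fun_on A U (h i)" for i
    unfolding h_def by (rule smooth_fun_on_coordinate[OF c(1)])
  have sM: "smooth_fun_on A U (\<lambda>q. M q $ i $ j)" for i j
    unfolding M_def using vfield_smooth[OF frame U h] by simp
  have sM': "smooth_fun_on A U (\<lambda>q. M' q $ i $ j)" for i j
    using vfield_smooth[OF assms U h] sM by (cases "j = k") (simp_all add: M'_def)
  \<comment> \<open>A kernel vector \<open>y\<close> of the matrix gives a combination of the frame
    that annihilates all chart coordinates. Such a tangent vector is 0, and then \<open>y\<close> is
    0 because the frame is independent.\<close>
  have detM: "det (M q) \<noteq> 0" if q: "q \<in> U" for q
  proof -
    have "y = 0" if y: "M q *v y = 0" for y :: "real ^ 'd"
    proof -
      let ?v = "\<Sum>j\<in>UNIV. y $ j *\<^sub>R E j q"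
      obtain w where w: "?v = chart_vector U c q w"
        using lincomb_tangent[of "\<lambda>j. y $ j" q] unfolding tangent_space_eq_range[OF c(1) q] by blast
      have "w $ i = 0" for i
      proof -
        have "w $ i = chart_vector U c q w (h i)"
          unfolding h_def chart_vector_coordinate[OF c(1) q] by (simp add: inner_axis)
        also have "\<dots> = (M q *v y) $ i"
          unfolding w[symmetric] by (simp add: sum_fun_apply scaleR_fun_def M_def matrix_vector_mult_def mult.commute)
        finally show ?thesis using y by simp
      qed
      then have "w = 0" by (simp add: vec_eq_iff)
      then have v0: "?v = 0" using w linear_0[OF linear_chart_vector[OF c(1) q]] by simp
      have "y $ j = 0" for j
        using coord_lincomb[of j q "\<lambda>j. y $ j"] coord_lincomb[of j q "\<lambda>j. 0"] v0 by simp
      then show ?thesis by (simp add: vec_eq_iff)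
    qed
    then show ?thesis
      using matrix_left_invertible_ker[of "M q"] invertible_left_inverse invertible_det_nz by metis
  qed
  have "cf X k q = det (M' q) * inverse (det (M q))" if q: "q \<in> U" for q
  proof -
    have "M q *v (\<chi> j. cf X j q) = (\<chi> i. X q (h i))"
      using tangent_apply[OF vfield_tangent[OF assms]]
      by (simp add: vec_eq_iff matrix_vector_mult_def M_def cf_def mult.commute)
    then have "(\<chi> j. cf X j q) $ k = det (M' q) / det (M q)"
      unfolding cramer[OF detM[OF q]] M'_def by (simp cong: if_cong)
    then show ?thesis by (simp add: divide_inverse)
  qed
  moreover have "smooth_fun_on A U (\<lambda>q. det (M' q) * inverse (det (M q)))"
    by (intro smooth_fun_on_mult smooth_fun_on_inverse smooth_fun_on_det U sM sM' detM)
  ultimately have "smooth_fun_on A U (cf X k)"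
    using smooth_fun_on_cong[OF U, of "\<lambda>q. det (M' q) * inverse (det (M q))"] by simp
  then show "\<exists>N. open N \<and> p \<in> N \<and> smooth_fun_on A N (cf X k)"
    using U c(2) by blast
qed

section \<open>Coefficient functions of vector fields in the frame\<close>

lemma cf_near: "X \<in> VF \<Longrightarrow> smooth_near A p (cf X k)"
  by (intro smooth_near_of_smooth cf_smooth)

lemma cf_lincomb: "cf (\<lambda>p. \<Sum>i\<in>UNIV. a i p *\<^sub>R E i p) k = a k"
  by (simp add: cf_def fun_eq_iff coord_lincomb)

lemma vfield_expansion: "X \<in> VF \<Longrightarrow> X = (\<lambda>p. \<Sum>k\<in>UNIV. cf X k p *\<^sub>R E k p)"
  unfolding cf_def using expansion vfield_tangent by blast

lemma vfield_apply: "X \<in> VF \<Longrightarrow> X p f = (\<Sum>k\<in>UNIV. cf X k p * E k p f)"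
  unfolding cf_def by (rule tangent_apply[OF vfield_tangent])

lemma cf_frame: "cf (E i) k = (\<lambda>p. if k = i then 1 else 0)"
  using eps by (auto simp: cf_def coord_def ortho fun_eq_iff)

lemma coord_comb:
  "u \<in> tangent_space A p \<Longrightarrow> v \<in> tangent_space A p \<Longrightarrow>
    coord k p (a *\<^sub>R u + b *\<^sub>R v) = a * coord k p u + b * coord k p v"
  using coord_linear unfolding linear_on_subspace_def by simp

lemma cf_add: "X \<in> VF \<Longrightarrow> Y \<in> VF \<Longrightarrow> cf (X + Y) k = (\<lambda>p. cf X k p + cf Y k p)"
  using coord_comb[OF vfield_tangent vfield_tangent, of X Y k _ 1 1]
  by (simp add: cf_def fun_eq_iff)

lemma cf_scale: "X \<in> VF \<Longrightarrow> cf (\<lambda>p. f p *\<^sub>R X p) k = (\<lambda>p. f p * cf X k p)"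
  using coord_comb[OF vfield_tangent vfield_tangent, of X X k _ _ 0]
  by (simp add: cf_def fun_eq_iff)

lemma metric_vfields:
  "X \<in> VF \<Longrightarrow> Y \<in> VF \<Longrightarrow> g p (X p) (Y p) = (\<Sum>k\<in>UNIV. \<epsilon> k * cf X k p * cf Y k p)"
  unfolding cf_def by (rule metric_expansion[OF vfield_tangent vfield_tangent])

lemma frame_metric: "pseudo_riemannian_metric A g"
  unfolding pseudo_riemannian_metric_def smooth_bilform_def
proof (intro conjI ballI allI impI bilform)
  show "smooth_fun_on A UNIV (\<lambda>p. g p (X p) (Y p))" if "X \<in> VF" "Y \<in> VF" for X Y
    unfolding metric_vfields[OF that]
    by (intro smooth_fun_on_sum smooth_fun_on_mult smooth_fun_on_const cf_smooth that open_UNIV)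
  show "g p u v = g p v u" if "u \<in> tangent_space A p" "v \<in> tangent_space A p" for p u v
    unfolding metric_expansion[OF that] metric_expansion[OF that(2,1)] by (simp add: mult_ac)
  show "u = 0" if u: "u \<in> tangent_space A p" and z: "\<forall>v\<in>tangent_space A p. g p u v = 0" for p u
  proof -
    have "coord k p u = 0" for k
      using z frame_tangent by (simp add: coord_def)
    then show ?thesis using expansion[OF u] by simp
  qed
qed

end

section \<open>The Levi-Civita connection of a frame with constant structure functions\<close>

lemma sum_rotate3:
  fixes f :: "'i \<Rightarrow> 'j \<Rightarrow> 'k \<Rightarrow> 'y::comm_monoid_add"
  shows "(\<Sum>k\<in>K. \<Sum>i\<in>I. \<Sum>j\<in>J. f i j k) = (\<Sum>i\<in>I. \<Sum>j\<in>J. \<Sum>k\<in>K. f i j k)"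
  by (subst sum.swap, intro sum.cong refl, subst sum.swap) (rule refl)

lemma is_levi_civitaD:
  assumes "is_levi_civita A g D" "X \<in> smooth_vfields A" "Y \<in> smooth_vfields A"
  shows "D X Y \<in> smooth_vfields A"
    and "D X Y p - D Y X p = lie_bracket A X Y p"
    and "Z \<in> smooth_vfields A \<Longrightarrow>
      X p (\<lambda>q. g q (Y q) (Z q)) = g p (D X Y p) (Z p) + g p (Y p) (D X Z p)"
proof -
  have "\<forall>X\<in>smooth_vfields A. \<forall>Y\<in>smooth_vfields A. D X Y \<in> smooth_vfields A"
    using assms(1) unfolding is_levi_civita_def affine_connection_def by (elim conjE)
  then show "D X Y \<in> smooth_vfields A" using assms(2,3) by simp
  have "\<forall>X\<in>smooth_vfields A. \<forall>Y\<in>smooth_vfields A. D X Y - D Y X = lie_bracket A X Y"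
    using assms(1) unfolding is_levi_civita_def by (elim conjE)
  from fun_cong[OF bspec[OF bspec[OF this assms(2)] assms(3)], of p]
  show "D X Y p - D Y X p = lie_bracket A X Y p" unfolding minus_apply .
  have "\<forall>X\<in>smooth_vfields A. \<forall>Y\<in>smooth_vfields A. \<forall>Z\<in>smooth_vfields A. \<forall>p.
       X p (\<lambda>q. g q (Y q) (Z q)) = g p (D X Y p) (Z p) + g p (Y p) (D X Z p)"
    using assms(1) unfolding is_levi_civita_def by (elim conjE)
  from spec[OF bspec[OF bspec[OF bspec[OF this assms(2)] assms(3)]]]
  show "X p (\<lambda>q. g q (Y q) (Z q)) = g p (D X Y p) (Z p) + g p (Y p) (D X Z p)"
    if "Z \<in> smooth_vfields A" using that .
qed

lemma is_levi_civita_outside: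
  assumes "is_levi_civita A g D" "\<not> (X \<in> smooth_vfields A \<and> Y \<in> smooth_vfields A)"
  shows "D X Y = 0"
proof -
  have "\<forall>X Y. X \<notin> smooth_vfields A \<or> Y \<notin> smooth_vfields A \<longrightarrow> D X Y = 0"
    using assms(1) unfolding is_levi_civita_def by (elim conjE)
  then show ?thesis using assms(2) by simp
qed

text \<open>Paired with a third field, the difference of the two connections is symmetric in the
  first two arguments, since the torsions agree, and skew in the last two, since both are metric;
  such a form vanishes. The hypothesis on extensions of tangent vectors turns this into
  orthogonality to the whole tangent space, so that nondegeneracy applies.\<close>

lemma (in smooth_mfd) levi_civita_unique:
  assumes g: "pseudo_riemannian_metric A g" and span: "\<And>p v. v \<in> tangent_space A p \<Longrightarrow> \<exists>Z\<in>smooth_vfields A. Z p = v"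
    and L: "is_levi_civita A g D" "is_levi_civita A g D'"
  shows "D = D'"
proof -
  let ?VF = "smooth_vfields A"
  have "D X Y p = D' X Y p" for X Y p
  proof (cases "X \<in> ?VF \<and> Y \<in> ?VF")
    case False
    then show ?thesis
      using is_levi_civita_outside[OF L(1)] is_levi_civita_outside[OF L(2)] by simp
  next
    case True
    have DT: "D X Y p \<in> tangent_space A p" "D' X Y p \<in> tangent_space A p" if "X \<in> ?VF" "Y \<in> ?VF" for X Y
      by (intro vfield_tangent is_levi_civitaD(1)[OF L(1)] is_levi_civitaD(1)[OF L(2)] that)+
    have sym: "g p u v = g p v u" if "u \<in> tangent_space A p" "v \<in> tangent_space A p" for u v
      using g that unfolding pseudo_riemannian_metric_def by simp
    define t where "t X Y Z = g p (D X Y p) (Z p) - g p (D' X Y p) (Z p)" for X Y Z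
    have diff: "g p (u - u') v = g p u v - g p u' v"
      if "u \<in> tangent_space A p" "u' \<in> tangent_space A p" "v \<in> tangent_space A p" for u u' v
    proof -
      have "linear_on_subspace (tangent_space A p) (\<lambda>u. g p u v)"
        using g that(3) unfolding pseudo_riemannian_metric_def bilform_field_def by simp
      from this[unfolded linear_on_subspace_def, rule_format, OF that(1,2), of 1 "-1"]
      show ?thesis by simp
    qed
    have t1: "t X Y Z = t Y X Z" if X: "X \<in> ?VF" and Y: "Y \<in> ?VF" and Z: "Z \<in> ?VF" for X Y Z
    proof -
      have "D X Y p - D Y X p = D' X Y p - D' Y X p"
        unfolding is_levi_civitaD(2)[OF L(1) X Y] is_levi_civitaD(2)[OF L(2) X Y] ..
      then have "g p (D X Y p - D Y X p) (Z p) = g p (D' X Y p - D' Y X p) (Z p)" by simp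
      then show ?thesis
        using X Y vfield_tangent[OF Z] by (simp add: diff DT t_def)
    qed
    have t2: "t X Y Z = - t X Z Y" if X: "X \<in> ?VF" and Y: "Y \<in> ?VF" and Z: "Z \<in> ?VF" for X Y Z
    proof -
      have "g p (D X Y p) (Z p) + g p (Y p) (D X Z p) = g p (D' X Y p) (Z p) + g p (Y p) (D' X Z p)"
        unfolding is_levi_civitaD(3)[OF L(1) X Y Z, symmetric] is_levi_civitaD(3)[OF L(2) X Y Z, symmetric] ..
      then show ?thesis
        using sym[OF vfield_tangent[OF Y]] DT X Z by (simp add: t_def)
    qed
    have t0: "t X Y Z = 0" if Z: "Z \<in> ?VF" for Z
    proof -
      have X: "X \<in> ?VF" and Y: "Y \<in> ?VF" using True by auto
      \<comment> \<open>Alternate the two symmetries: t X Y Z = t Y X Z = - t Y Z X = - t Z Y X = t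
        Z X Y = t X Z Y = - t X Y Z.\<close>
      have "t X Y Z = - t X Y Z"
        using t1[OF X Y Z] t2[OF Y X Z] t1[OF Y Z X] t2[OF Z Y X] t1[OF Z X Y] t2[OF X Z Y] by simp
      then show ?thesis by simp
    qed
    have "g p (D X Y p - D' X Y p) v = 0" if v: "v \<in> tangent_space A p" for v
    proof -
      obtain Z where Z: "Z \<in> ?VF" "Z p = v" using span[OF v] by (rule bexE)
      have "t X Y Z = g p (D X Y p - D' X Y p) (Z p)"
        unfolding t_def using diff DT vfield_tangent[OF Z(1)] True by simp
      then show ?thesis using t0[OF Z(1)] Z(2) by simp
    qed
    moreover have "D X Y p - D' X Y p \<in> tangent_space A p"
      using DT True subspace_diff[OF subspace_tangent_space] by simp
    ultimately have "D X Y p - D' X Y p = 0"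
      using g unfolding pseudo_riemannian_metric_def by blast
    then show ?thesis by simp
  qed
  then show ?thesis by (intro ext) (simp only:)
qed

text \<open>Constancy of \<open>C\<close> is the trace left by left-invariance: together with the
  constant Gram matrix it makes the Christoffel symbols constants.\<close>

locale frame_algebra = orthonormal_frame A g E \<epsilon>
  for A :: "('a::{t2_space, second_countable_topology}, real ^ 'd) atlas" and g E \<epsilon> +
  fixes C :: "'d \<Rightarrow> 'd \<Rightarrow> 'd \<Rightarrow> real"
  assumes brackets: "lie_bracket A (E i) (E j) = (\<Sum>k\<in>UNIV. C i j k *\<^sub>R E k)"
begin

lemma bracket_apply: "lie_bracket A (E i) (E j) p f = (\<Sum>k\<in>UNIV. C i j k * E k p f)"
  unfolding brackets by (simp add: sum_fun_apply scaleR_fun_def)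

lemma structure_antisym: "C i j k = - C j i k"
proof -
  \<comment> \<open>The constants are the same at all points, so comparing coefficients at one
    arbitrary point is enough.\<close>
  fix p
  have "lie_bracket A (E i) (E j) p = - lie_bracket A (E j) (E i) p"
    by (simp add: lie_bracket_def fun_eq_iff)
  then have "(\<Sum>k\<in>UNIV. C i j k *\<^sub>R E k p) = (\<Sum>k\<in>UNIV. (- C j i k) *\<^sub>R E k p)"
    unfolding brackets by (simp add: sum_fun_apply scaleR_fun_def fun_eq_iff sum_negf)
  then show ?thesis
    using coord_lincomb[of k p "C i j"] coord_lincomb[of k p "\<lambda>k. - C j i k"] by simp
qed

text \<open>Koszul's formula.\<close>

definition \<Gamma> :: "'d \<Rightarrow> 'd \<Rightarrow> 'd \<Rightarrow> real" where
  "\<Gamma> i j k = \<epsilon> k / 2 * (\<epsilon> k * C i j k - \<epsilon> i * C j k i + \<epsilon> j * C k i j)"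

text \<open>By antisymmetry of \<open>C\<close> the terms with \<open>\<epsilon> i\<close> and
  \<open>\<epsilon> j\<close> cancel, and the two remaining ones add up.\<close>

lemma \<Gamma>_torsion: "\<Gamma> i j k - \<Gamma> j i k = C i j k"
proof -
  have "\<Gamma> i j k - \<Gamma> j i k = \<epsilon> k * \<epsilon> k * C i j k"
    unfolding \<Gamma>_def structure_antisym[of j i k] structure_antisym[of k j i] structure_antisym[of i k j]
    by (simp add: field_simps)
  then show ?thesis by (simp add: eps)
qed

lemma \<epsilon>\<Gamma>: "\<epsilon> k * \<Gamma> i j k = (\<epsilon> k * C i j k - \<epsilon> i * C j k i + \<epsilon> j * C k i j) / 2"
proof -
  have "\<epsilon> k * \<Gamma> i j k = (\<epsilon> k * \<epsilon> k) * (\<epsilon> k * C i j k - \<epsilon> i * C j k i + \<epsilon> j * C k i j) / 2"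
    by (simp add: \<Gamma>_def)
  then show ?thesis by (simp add: eps)
qed

text \<open>The products of frame fields are constant, so compatibility with g means that
  \<open>g (\<nabla>_i E j) (E k)\<close>, which is \<open>\<epsilon> k * \<Gamma> i j k\<close>, is
  skew in j and k.\<close>

lemma \<Gamma>_metric: "\<epsilon> k * \<Gamma> i j k + \<epsilon> j * \<Gamma> i k j = 0"
  unfolding \<epsilon>\<Gamma> structure_antisym[of k j i] structure_antisym[of i k j] structure_antisym[of j i k] by (simp add: field_simps)

text \<open>The \<open>k\<close>-th component of the covariant derivative of Y along X; the last
  index of \<Gamma> is the upper one.\<close>

definition conn :: "'a vfield \<Rightarrow> 'a vfield \<Rightarrow> 'd \<Rightarrow> 'a \<Rightarrow> real" where
  "conn X Y k = (\<lambda>p. X p (cf Y k) + (\<Sum>i\<in>UNIV. \<Sum>j\<in>UNIV. cf X i p * cf Y j p * \<Gamma> i j k))"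

definition nabla :: "'a vfield \<Rightarrow> 'a vfield \<Rightarrow> 'a vfield" where
  "nabla X Y = (if X \<in> VF \<and> Y \<in> VF then (\<lambda>p. \<Sum>k\<in>UNIV. conn X Y k p *\<^sub>R E k p) else 0)"

lemma conn_smooth:
  assumes "X \<in> VF" "Y \<in> VF"
  shows "smooth_fun_on A UNIV (conn X Y k)"
  unfolding conn_def
proof (rule smooth_fun_on_add[OF open_UNIV vfield_smooth[OF assms(1) open_UNIV cf_smooth[OF assms(2)]]])
  show "smooth_fun_on A UNIV (\<lambda>p. \<Sum>i\<in>UNIV. \<Sum>j\<in>UNIV. cf X i p * cf Y j p * \<Gamma> i j k)"
    by (intro smooth_fun_on_sum smooth_fun_on_mult smooth_fun_on_const cf_smooth assms open_UNIV)
qed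

lemma nabla_vfield: "X \<in> VF \<Longrightarrow> Y \<in> VF \<Longrightarrow> nabla X Y \<in> VF"
  unfolding nabla_def using vfield_lincomb[of UNIV E "conn X Y"] frame conn_smooth by simp

lemma cf_nabla: "X \<in> VF \<Longrightarrow> Y \<in> VF \<Longrightarrow> cf (nabla X Y) k = conn X Y k"
  unfolding nabla_def by (simp add: cf_lincomb)

section \<open>The candidate satisfies the axioms of the Levi-Civita connection\<close>

lemma conn_add_left:
  assumes "X \<in> VF" "X' \<in> VF"
  shows "conn (X + X') Y k p = conn X Y k p + conn X' Y k p"
  using assms by (simp add: conn_def cf_add algebra_simps sum.distrib)

lemma conn_add_right:
  assumes "X \<in> VF" "Y \<in> VF" "Y' \<in> VF"
  shows "conn X (Y + Y') k p = conn X Y k p + conn X Y' k p"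
  using assms tangent_add[OF vfield_tangent[OF assms(1)] cf_near cf_near, of Y Y' p k k]
  by (simp add: conn_def cf_add algebra_simps sum.distrib)

lemma conn_scale_left:
  assumes "X \<in> VF"
  shows "conn (\<lambda>p. f p *\<^sub>R X p) Y k p = f p * conn X Y k p"
  unfolding conn_def cf_scale[OF assms] by (simp add: scaleR_fun_def algebra_simps sum_distrib_left)

lemma conn_scale_right:
  assumes "X \<in> VF" "Y \<in> VF" "smooth_fun_on A UNIV f"
  shows "conn X (\<lambda>p. f p *\<^sub>R Y p) k p = X p f * cf Y k p + f p * conn X Y k p"
  using assms tangent_mult[OF vfield_tangent[OF assms(1)] smooth_near_of_smooth[OF assms(3)] cf_near[OF assms(2)], of p k]
  by (simp add: conn_def cf_scale algebra_simps sum_distrib_left)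

lemma affine_nabla: "affine_connection A nabla"
  unfolding affine_connection_def
proof (intro conjI ballI allI impI)
  show "nabla X Y \<in> VF" if "X \<in> VF" "Y \<in> VF" for X Y
    using nabla_vfield that .
next
  fix X X' Y assume "X \<in> VF" "X' \<in> VF" "Y \<in> VF"
  then show "nabla (X + X') Y = nabla X Y + nabla X' Y" "nabla Y (X + X') = nabla Y X + nabla Y X'"
    by (simp_all add: nabla_def vfield_add fun_eq_iff conn_add_left conn_add_right scaleR_add_left sum.distrib)
next
  fix f X Y assume f: "smooth_fun_on A UNIV f" and XY: "X \<in> VF" "Y \<in> VF"
  show "nabla (\<lambda>p. f p *\<^sub>R X p) Y = (\<lambda>p. f p *\<^sub>R nabla X Y p)"
    using f XY by (simp add: nabla_def vfield_scale conn_scale_left scaleR_sum_right)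
  have "(\<Sum>k\<in>UNIV. (X p f * cf Y k p) *\<^sub>R E k p) = X p f *\<^sub>R Y p" for p
    unfolding scaleR_scaleR[symmetric] scaleR_sum_right[symmetric]
    using fun_cong[OF vfield_expansion[OF XY(2)], of p] by simp
  then show "nabla X (\<lambda>p. f p *\<^sub>R Y p) = (\<lambda>p. X p f *\<^sub>R Y p + f p *\<^sub>R nabla X Y p)"
    using f XY by (simp add: nabla_def vfield_scale conn_scale_right scaleR_sum_right scaleR_add_left sum.distrib)
qed

text \<open>The product rule splits off a first-order part from the second-order part, whose
  coefficients are bilinear in X and Y. Exchanging X and Y and subtracting turns the latter into
  brackets of the frame.\<close>

lemma second_derivative:
  assumes X: "X \<in> VF" and Y: "Y \<in> VF" and f: "smooth_near A p f"
  shows "X p (\<lambda>q. Y q f) = (\<Sum>k\<in>UNIV. X p (cf Y k) * E k p f) +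
    (\<Sum>i\<in>UNIV. \<Sum>j\<in>UNIV. cf X i p * cf Y j p * E i p (\<lambda>q. E j q f))"
proof -
  note T = vfield_tangent[OF X, of p]
  have Ef: "smooth_near A p (\<lambda>q. E j q f)" for j
    by (rule vfield_smooth_near[OF frame f])
  have "X p (\<lambda>q. Y q f) = X p (\<lambda>q. \<Sum>j\<in>UNIV. cf Y j q * E j q f)"
    by (simp add: vfield_apply[OF Y])
  also have "\<dots> = (\<Sum>j\<in>UNIV. X p (\<lambda>q. cf Y j q * E j q f))"
    by (intro tangent_sum[OF T] smooth_near_mult cf_near[OF Y] Ef)
  also have "\<dots> = (\<Sum>j\<in>UNIV. cf Y j p * X p (\<lambda>q. E j q f) + E j p f * X p (cf Y j))"
    by (intro sum.cong refl tangent_mult[OF T cf_near[OF Y] Ef])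
  also have "\<dots> = (\<Sum>j\<in>UNIV. X p (cf Y j) * E j p f) +
      (\<Sum>j\<in>UNIV. \<Sum>i\<in>UNIV. cf X i p * cf Y j p * E i p (\<lambda>q. E j q f))"
    by (simp add: sum.distrib vfield_apply[OF X] sum_distrib_left mult_ac)
  also have "(\<Sum>j\<in>UNIV. \<Sum>i\<in>UNIV. cf X i p * cf Y j p * E i p (\<lambda>q. E j q f)) =
      (\<Sum>i\<in>UNIV. \<Sum>j\<in>UNIV. cf X i p * cf Y j p * E i p (\<lambda>q. E j q f))"
    by (rule sum.swap)
  finally show ?thesis .
qed

lemma nabla_torsion:
  assumes X: "X \<in> VF" and Y: "Y \<in> VF"
  shows "nabla X Y - nabla Y X = lie_bracket A X Y"
proof (intro ext)
  fix p f
  have nT: "nabla X Y p \<in> tangent_space A p" "nabla Y X p \<in> tangent_space A p"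
    using vfield_tangent nabla_vfield X Y by auto
  show "(nabla X Y - nabla Y X) p f = lie_bracket A X Y p f"
  proof (cases "smooth_near A p f")
    \<comment> \<open>Tangent vectors and \<open>lie_bracket\<close> are both 0 on such functions by
      convention.\<close>
    case False
    then show ?thesis
      using tangent_not_smooth[OF nT(1)] tangent_not_smooth[OF nT(2)] by (simp add: lie_bracket_def)
  next
    case True
    let ?x = "\<lambda>i. cf X i p" and ?y = "\<lambda>i. cf Y i p"
    have swap: "(\<Sum>i\<in>UNIV. \<Sum>j\<in>UNIV. ?y i * ?x j * G i j) = (\<Sum>i\<in>UNIV. \<Sum>j\<in>UNIV. ?x i * ?y j * G j i)"
      for G :: "'d \<Rightarrow> 'd \<Rightarrow> real"
      by (subst sum.swap) (simp add: mult_ac)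
    have "lie_bracket A X Y p f = X p (\<lambda>q. Y q f) - Y p (\<lambda>q. X q f)"
      using True by (simp add: lie_bracket_def)
    also have "\<dots> = (\<Sum>k\<in>UNIV. (X p (cf Y k) - Y p (cf X k)) * E k p f) +
        (\<Sum>i\<in>UNIV. \<Sum>j\<in>UNIV. ?x i * ?y j * (E i p (\<lambda>q. E j q f) - E j p (\<lambda>q. E i q f)))"
      unfolding second_derivative[OF X Y True] second_derivative[OF Y X True] swap
      by (simp add: sum_subtractf algebra_simps)
    also have "(\<Sum>i\<in>UNIV. \<Sum>j\<in>UNIV. ?x i * ?y j * (E i p (\<lambda>q. E j q f) - E j p (\<lambda>q. E i q f))) =
        (\<Sum>i\<in>UNIV. \<Sum>j\<in>UNIV. \<Sum>k\<in>UNIV. ?x i * ?y j * C i j k * E k p f)"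
    proof (intro sum.cong refl)
      fix i j
      have "E i p (\<lambda>q. E j q f) - E j p (\<lambda>q. E i q f) = (\<Sum>k\<in>UNIV. C i j k * E k p f)"
        using bracket_apply[of i j p f] True by (simp add: lie_bracket_def)
      then show "?x i * ?y j * (E i p (\<lambda>q. E j q f) - E j p (\<lambda>q. E i q f)) =
          (\<Sum>k\<in>UNIV. ?x i * ?y j * C i j k * E k p f)"
        by (simp add: sum_distrib_left mult_ac)
    qed
    also have "\<dots> = (\<Sum>k\<in>UNIV. \<Sum>i\<in>UNIV. \<Sum>j\<in>UNIV. ?x i * ?y j * C i j k * E k p f)"
      by (rule sum_rotate3[symmetric])
    also have "(\<Sum>k\<in>UNIV. (X p (cf Y k) - Y p (cf X k)) * E k p f) + \<dots> =
        (\<Sum>k\<in>UNIV. (conn X Y k p - conn Y X k p) * E k p f)"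
      unfolding sum.distrib[symmetric]
    proof (intro sum.cong refl)
      fix k
      have "conn X Y k p - conn Y X k p = X p (cf Y k) - Y p (cf X k) +
          (\<Sum>i\<in>UNIV. \<Sum>j\<in>UNIV. ?x i * ?y j * (\<Gamma> i j k - \<Gamma> j i k))"
        unfolding conn_def swap by (simp add: sum_subtractf algebra_simps)
      then show "(X p (cf Y k) - Y p (cf X k)) * E k p f + (\<Sum>i\<in>UNIV. \<Sum>j\<in>UNIV. ?x i * ?y j * C i j k * E k p f) =
          (conn X Y k p - conn Y X k p) * E k p f"
        by (simp add: \<Gamma>_torsion sum_distrib_right distrib_right)
    qed
    also have "\<dots> = (nabla X Y - nabla Y X) p f"
      using X Y by (simp add: nabla_def sum_fun_apply scaleR_fun_def left_diff_distrib sum_subtractf)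
    finally show ?thesis ..
  qed
qed

lemma nabla_metric:
  assumes X: "X \<in> VF" and Y: "Y \<in> VF" and Z: "Z \<in> VF"
  shows "X p (\<lambda>q. g q (Y q) (Z q)) = g p (nabla X Y p) (Z p) + g p (Y p) (nabla X Z p)"
proof -
  note T = vfield_tangent[OF X, of p]
  let ?x = "\<lambda>i. cf X i p" and ?y = "\<lambda>i. cf Y i p" and ?z = "\<lambda>i. cf Z i p"
  have "X p (\<lambda>q. g q (Y q) (Z q)) = X p (\<lambda>q. \<Sum>k\<in>UNIV. \<epsilon> k * (cf Y k q * cf Z k q))"
    by (simp add: metric_vfields[OF Y Z] mult_ac)
  also have "\<dots> = (\<Sum>k\<in>UNIV. X p (\<lambda>q. \<epsilon> k * (cf Y k q * cf Z k q)))"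
    by (intro tangent_sum[OF T] smooth_near_mult smooth_near_const cf_near Y Z)
  also have "\<dots> = (\<Sum>k\<in>UNIV. \<epsilon> k * (?y k * X p (cf Z k) + ?z k * X p (cf Y k)))"
    by (intro sum.cong refl)
      (simp add: tangent_cmult[OF T] smooth_near_mult cf_near Y Z tangent_mult[OF T])
  finally have lhs: "X p (\<lambda>q. g q (Y q) (Z q)) = \<dots>" .
  \<comment> \<open>These are the Christoffel terms of the two summands. Exchanging the names j and
    k in the second sum collects the factor that \<open>\<Gamma>_metric\<close> shows to be
    0.\<close>
  have "(\<Sum>k\<in>UNIV. \<Sum>i\<in>UNIV. \<Sum>j\<in>UNIV. ?x i * ?y j * ?z k * (\<epsilon> k * \<Gamma> i j k)) +
        (\<Sum>k\<in>UNIV. \<Sum>i\<in>UNIV. \<Sum>j\<in>UNIV. ?x i * ?z j * ?y k * (\<epsilon> k * \<Gamma> i j k)) =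
        (\<Sum>i\<in>UNIV. \<Sum>j\<in>UNIV. \<Sum>k\<in>UNIV. ?x i * ?y j * ?z k * (\<epsilon> k * \<Gamma> i j k + \<epsilon> j * \<Gamma> i k j))"
  proof -
    have "(\<Sum>k\<in>UNIV. \<Sum>i\<in>UNIV. \<Sum>j\<in>UNIV. ?x i * ?z j * ?y k * (\<epsilon> k * \<Gamma> i j k)) =
        (\<Sum>i\<in>UNIV. \<Sum>j\<in>UNIV. \<Sum>k\<in>UNIV. ?x i * ?y j * ?z k * (\<epsilon> j * \<Gamma> i k j))"
      by (subst sum.swap) (simp add: mult_ac)
    then show ?thesis
      unfolding sum_rotate3[of "\<lambda>i j k. ?x i * ?y j * ?z k * (\<epsilon> k * \<Gamma> i j k)"]
      by (simp add: distrib_left sum.distrib)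
  qed
  also have "\<dots> = 0" by (simp add: \<Gamma>_metric)
  finally have zero: "(\<Sum>k\<in>UNIV. \<Sum>i\<in>UNIV. \<Sum>j\<in>UNIV. ?x i * ?y j * ?z k * (\<epsilon> k * \<Gamma> i j k)) +
        (\<Sum>k\<in>UNIV. \<Sum>i\<in>UNIV. \<Sum>j\<in>UNIV. ?x i * ?z j * ?y k * (\<epsilon> k * \<Gamma> i j k)) = 0" .
  have christoffel: "\<epsilon> k * conn X V k p * w k = \<epsilon> k * (w k * X p (cf V k)) +
      (\<Sum>i\<in>UNIV. \<Sum>j\<in>UNIV. ?x i * cf V j p * w k * (\<epsilon> k * \<Gamma> i j k))" for V k w
  proof -
    have "(\<Sum>i\<in>UNIV. \<Sum>j\<in>UNIV. ?x i * cf V j p * w k * (\<epsilon> k * \<Gamma> i j k)) =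
        \<epsilon> k * (\<Sum>i\<in>UNIV. \<Sum>j\<in>UNIV. ?x i * cf V j p * \<Gamma> i j k) * w k"
      by (simp add: sum_distrib_left sum_distrib_right mult_ac)
    then show ?thesis by (simp add: conn_def algebra_simps)
  qed
  have "g p (nabla X Y p) (Z p) + g p (Y p) (nabla X Z p) =
      (\<Sum>k\<in>UNIV. \<epsilon> k * conn X Y k p * ?z k) + (\<Sum>k\<in>UNIV. \<epsilon> k * conn X Z k p * ?y k)"
    by (simp add: metric_vfields nabla_vfield cf_nabla X Y Z mult_ac)
  also have "\<dots> = (\<Sum>k\<in>UNIV. \<epsilon> k * (?z k * X p (cf Y k))) + (\<Sum>k\<in>UNIV. \<epsilon> k * (?y k * X p (cf Z k)))"
    unfolding christoffel[of _ Y ?z] christoffel[of _ Z ?y] sum.distrib using zero by linarith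
  also have "\<dots> = (\<Sum>k\<in>UNIV. \<epsilon> k * (?y k * X p (cf Z k) + ?z k * X p (cf Y k)))"
    by (simp add: distrib_left sum.distrib)
  finally show ?thesis unfolding lhs ..
qed

lemma levi_civita_nabla: "is_levi_civita A g nabla"
  unfolding is_levi_civita_def
proof (intro conjI ballI allI impI)
  show "nabla X Y = 0" if "X \<notin> VF \<or> Y \<notin> VF" for X Y
    using that by (auto simp: nabla_def)
qed (fact affine_nabla nabla_torsion nabla_metric)+

lemma levi_civita_eq: "levi_civita A g = nabla"
  unfolding levi_civita_def
proof (rule the_equality[where P="is_levi_civita A g", OF levi_civita_nabla])
  have "\<exists>Z\<in>VF. Z p = v" if "v \<in> tangent_space A p" for p v
  proof
    \<comment> \<open>A single tangent vector extends to a smooth field by keeping its frame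
      coefficients constant.\<close>
    show "(\<lambda>q. \<Sum>k\<in>UNIV. coord k p v *\<^sub>R E k q) \<in> VF"
      by (intro vfield_lincomb frame smooth_fun_on_const open_UNIV)
  qed (rule expansion[OF that, symmetric])
  then show "D = nabla" if "is_levi_civita A g D" for D
    by (rule levi_civita_unique[OF frame_metric _ that levi_civita_nabla])
qed

end

section \<open>Almost contact structures with constant coefficients\<close>

text \<open>\<open>P\<close> is the matrix of \<phi> with the images of the frame as rows, and
  \<open>r\<close> is the index of \<xi>. The assumptions on \<open>P\<close> are the componentwise
  forms of the axioms for the square of \<phi>, \<eta> \<circ> \<phi> = 0, \<phi> \<xi> = 0 and the
  B-metric identity.\<close>

locale frame_structure = frame_algebra A g E \<epsilon> C
  for A :: "('a::{t2_space, second_countable_topology}, real ^ 'd) atlas" and g E \<epsilon> C +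
  fixes \<phi> :: "'a endo" and \<eta> :: "'a oneform" and P :: "'d \<Rightarrow> 'd \<Rightarrow> real" and r :: 'd
  assumes endo: "endo_field A \<phi>" and oneform: "oneform_field A \<eta>"
    and phi_frame: "\<phi> p (E j p) = (\<Sum>k\<in>UNIV. P j k *\<^sub>R E k p)"
    and eta_frame: "\<eta> p (E j p) = (if j = r then 1 else 0)"
    and P_square: "(\<Sum>l\<in>UNIV. P j l * P l k) = (if j = k \<and> j \<noteq> r then -1 else 0)"
    and P_range: "P j r = 0" and P_kernel: "P r k = 0"
    and P_metric: "(\<Sum>k\<in>UNIV. \<epsilon> k * P i k * P j k) = (if i = j \<and> i \<noteq> r then - \<epsilon> i else 0)"
    and eps_r: "\<epsilon> r = 1"
begin

section \<open>The structure tensors in frame coordinates\<close>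

lemma phi_tangent: "v \<in> tangent_space A p \<Longrightarrow> \<phi> p v \<in> tangent_space A p"
  using endo unfolding endo_field_def by blast

lemma phi_expansion:
  assumes "v \<in> tangent_space A p"
  shows "\<phi> p v = (\<Sum>k\<in>UNIV. (\<Sum>j\<in>UNIV. coord j p v * P j k) *\<^sub>R E k p)"
proof -
  have lin: "linear_on_subspace (tangent_space A p) (\<phi> p)"
    using endo unfolding endo_field_def by simp
  have "\<phi> p v = \<phi> p (\<Sum>j\<in>UNIV. coord j p v *\<^sub>R E j p)"
    using expansion[OF assms] by simp
  also have "\<dots> = (\<Sum>j\<in>UNIV. coord j p v *\<^sub>R \<phi> p (E j p))"
    by (rule linear_on_subspace_sum[OF lin subspace_tangent_space frame_tangent])
  also have "\<dots> = (\<Sum>j\<in>UNIV. \<Sum>k\<in>UNIV. (coord j p v * P j k) *\<^sub>R E k p)"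
    by (simp add: phi_frame scaleR_sum_right)
  also have "\<dots> = (\<Sum>k\<in>UNIV. \<Sum>j\<in>UNIV. (coord j p v * P j k) *\<^sub>R E k p)"
    by (rule sum.swap)
  finally show ?thesis by (simp add: scaleR_sum_left)
qed

lemma coord_phi:
  assumes "v \<in> tangent_space A p"
  shows "coord k p (\<phi> p v) = (\<Sum>j\<in>UNIV. coord j p v * P j k)"
  unfolding phi_expansion[OF assms] by (rule coord_lincomb)

lemma eta_eq_coord:
  assumes "v \<in> tangent_space A p"
  shows "\<eta> p v = coord r p v"
proof -
  have lin: "linear_on_subspace (tangent_space A p) (\<eta> p)"
    using oneform unfolding oneform_field_def by simp
  have "\<eta> p v = \<eta> p (\<Sum>j\<in>UNIV. coord j p v *\<^sub>R E j p)"
    using expansion[OF assms] by simp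
  also have "\<dots> = (\<Sum>j\<in>UNIV. coord j p v *\<^sub>R \<eta> p (E j p))"
    by (rule linear_on_subspace_sum[OF lin subspace_tangent_space frame_tangent])
  also have "\<dots> = (\<Sum>j\<in>UNIV. if j = r then coord j p v else 0)"
    by (intro sum.cong) (simp_all add: eta_frame)
  finally show ?thesis by simp
qed

lemma eta_vfield: "X \<in> VF \<Longrightarrow> \<eta> p (X p) = cf X r p"
  unfolding cf_def by (rule eta_eq_coord[OF vfield_tangent])

lemma cf_phi: "X \<in> VF \<Longrightarrow> cf (endo_apply \<phi> X) k = (\<lambda>p. \<Sum>j\<in>UNIV. cf X j p * P j k)"
  unfolding cf_def endo_apply_def by (simp add: coord_phi vfield_tangent)

lemma phi_vfield:
  assumes "X \<in> VF"
  shows "endo_apply \<phi> X \<in> VF"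
proof -
  have "endo_apply \<phi> X = (\<lambda>p. \<Sum>k\<in>UNIV. (\<Sum>j\<in>UNIV. cf X j p * P j k) *\<^sub>R E k p)"
    unfolding endo_apply_def cf_def using phi_expansion[OF vfield_tangent[OF assms]] by simp
  also have "\<dots> \<in> VF"
    by (intro vfield_lincomb frame smooth_fun_on_sum smooth_fun_on_mult smooth_fun_on_const
        cf_smooth assms open_UNIV)
  finally show ?thesis .
qed

lemma phi_square:
  assumes x: "x \<in> tangent_space A p"
  shows "\<phi> p (\<phi> p x) = - x + \<eta> p x *\<^sub>R E r p"
proof (rule tangent_eqI)
  show "\<phi> p (\<phi> p x) \<in> tangent_space A p" by (intro phi_tangent x)
  show "- x + \<eta> p x *\<^sub>R E r p \<in> tangent_space A p"
    by (intro subspace_add subspace_neg subspace_scale subspace_tangent_space frame_tangent x)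
  fix k
  have "coord k p (\<phi> p (\<phi> p x)) = (\<Sum>l\<in>UNIV. \<Sum>j\<in>UNIV. coord j p x * P j l * P l k)"
    by (simp add: coord_phi phi_tangent x sum_distrib_right)
  also have "\<dots> = (\<Sum>j\<in>UNIV. coord j p x * (\<Sum>l\<in>UNIV. P j l * P l k))"
    by (subst sum.swap) (simp add: sum_distrib_left mult_ac)
  also have "\<dots> = (\<Sum>j\<in>UNIV. if j = k then (if k = r then 0 else - coord k p x) else 0)"
    unfolding P_square by (intro sum.cong) auto
  also have "\<dots> = - coord k p x + \<eta> p x * coord k p (E r p)"
    by (simp add: eta_eq_coord[OF x] coord_def ortho eps_r)
  also have "\<dots> = coord k p (- x + \<eta> p x *\<^sub>R E r p)"
    using coord_comb[OF x frame_tangent, of k "-1" "\<eta> p x" r] by simp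
  finally show "coord k p (\<phi> p (\<phi> p x)) = coord k p (- x + \<eta> p x *\<^sub>R E r p)" .
qed

lemma phi_metric:
  assumes x: "x \<in> tangent_space A p" and y: "y \<in> tangent_space A p"
  shows "g p (\<phi> p x) (\<phi> p y) = - g p x y + \<eta> p x * \<eta> p y"
proof -
  let ?x = "\<lambda>i. coord i p x" and ?y = "\<lambda>i. coord i p y"
  have "g p (\<phi> p x) (\<phi> p y) = (\<Sum>k\<in>UNIV. \<Sum>i\<in>UNIV. \<Sum>j\<in>UNIV. ?x i * ?y j * (\<epsilon> k * P i k * P j k))"
    by (simp add: metric_expansion phi_tangent x y coord_phi sum_distrib_left sum_distrib_right mult_ac)
  also have "\<dots> = (\<Sum>i\<in>UNIV. \<Sum>j\<in>UNIV. ?x i * ?y j * (\<Sum>k\<in>UNIV. \<epsilon> k * P i k * P j k))"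
    by (subst sum_rotate3) (simp only: sum_distrib_left)
  also have "\<dots> = (\<Sum>i\<in>UNIV. \<Sum>j\<in>UNIV. if j = i then (if i = r then 0 else - (\<epsilon> i * ?x i * ?y i)) else 0)"
    unfolding P_metric by (intro sum.cong) auto
  also have "\<dots> = (\<Sum>i\<in>UNIV. - (\<epsilon> i * ?x i * ?y i) + (if i = r then ?x r * ?y r else 0))"
    by (intro sum.cong) (auto simp: eps_r)
  also have "\<dots> = - g p x y + \<eta> p x * \<eta> p y"
    by (simp add: metric_expansion x y eta_eq_coord sum.distrib sum_negf sum_subtractf)
  finally show ?thesis .
qed

text \<open>\<open>has_signature\<close> lists the negative directions first; the bijection
  \<open>t\<close> rearranges the frame accordingly.\<close>

lemma frame_has_signature:
  assumes t: "bij_betw t {..<m + n} UNIV" and neg: "\<And>i. i < m + n \<Longrightarrow> \<epsilon> (t i) = (if i < m then -1 else 1)"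
  shows "has_signature A g m n"
  unfolding has_signature_def
proof (intro allI exI conjI impI)
  fix p
  show "is_basis_of {..<m + n} (\<lambda>i. E (t i) p) (tangent_space A p)"
    unfolding is_basis_of_def
  proof (intro conjI)
    show "inj_on (\<lambda>i. E (t i) p) {..<m + n}"
      using t frame_inj[of p] unfolding bij_betw_def inj_on_def by blast
    have "(\<lambda>i. E (t i) p) ` {..<m + n} = (\<lambda>i. E i p) ` t ` {..<m + n}"
      by (simp add: image_image)
    then have "(\<lambda>i. E (t i) p) ` {..<m + n} = range (\<lambda>i. E i p)"
      using t by (simp add: bij_betw_def)
    then show "independent ((\<lambda>i. E (t i) p) ` {..<m + n})"
      "span ((\<lambda>i. E (t i) p) ` {..<m + n}) = tangent_space A p"
      by (simp_all only: frame_independent frame_span not_False_eq_True)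
  qed
  fix i j assume ij: "i < m + n" "j < m + n"
  then have "t i = t j \<longleftrightarrow> i = j"
    using t unfolding bij_betw_def inj_on_def by auto
  then show "g p (E (t i) p) (E (t j) p) = (if i \<noteq> j then 0 else if i < m then -1 else 1)"
    using neg[OF ij(1)] by (cases "i = j") (simp_all add: ortho)
qed

lemma almost_contact:
  assumes "CARD('d) = 2 * n + 1" "has_signature A g n (n + 1)"
  shows "almost_contact_B_metric_manifold A \<phi> (E r) \<eta> g"
  unfolding almost_contact_B_metric_manifold_def
proof (intro conjI allI ballI exI)
  show "smooth_endo A \<phi>" unfolding smooth_endo_def by (intro ballI phi_vfield)
  show "smooth_oneform A \<eta>"
    unfolding smooth_oneform_def using cf_smooth by (simp add: eta_vfield)
  show "\<phi> p (E r p) = 0" for p by (simp add: phi_frame P_kernel)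
  show "\<eta> p (E r p) = 1" for p by (simp add: eta_frame)
  show "\<eta> p (\<phi> p x) = 0" if "x \<in> tangent_space A p" for p x
    by (simp add: eta_eq_coord phi_tangent coord_phi that P_range)
qed (fact smooth endo oneform frame frame_metric assms | rule phi_square phi_metric; assumption)+

text \<open>The component \<open>g ((\<nabla>_i \<phi>) (E j)) (E k)\<close>: the first sum comes
  from differentiating \<phi> \<open>(E j)\<close>, the second from applying \<phi>
  afterwards.\<close>

definition Fc :: "'d \<Rightarrow> 'd \<Rightarrow> 'd \<Rightarrow> real" where
  "Fc i j k = \<epsilon> k * ((\<Sum>l\<in>UNIV. P j l * \<Gamma> i l k) - (\<Sum>l\<in>UNIV. \<Gamma> i j l * P l k))"

text \<open>Because \<open>P\<close> is constant, the derivatives of the coefficients of Y enter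
  \<open>\<nabla>_X (\<phi> Y)\<close> and \<open>\<phi> (\<nabla>_X Y)\<close> in the same way and
  cancel. What is left is tensorial in all three arguments.\<close>

lemma fundamental_F_frame:
  assumes X: "X \<in> VF" and Y: "Y \<in> VF" and Z: "Z \<in> VF"
  shows "fundamental_F A \<phi> g X Y Z p =
    (\<Sum>i\<in>UNIV. \<Sum>j\<in>UNIV. \<Sum>k\<in>UNIV. cf X i p * cf Y j p * cf Z k p * Fc i j k)"
proof -
  let ?x = "\<lambda>i. cf X i p" and ?y = "\<lambda>i. cf Y i p" and ?z = "\<lambda>i. cf Z i p"
  note T = vfield_tangent[OF X, of p]
  define u where "u = nabla X (endo_apply \<phi> Y) p"
  define v where "v = nabla X Y p"
  have uT: "u \<in> tangent_space A p" and vT: "v \<in> tangent_space A p"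
    unfolding u_def v_def by (intro vfield_tangent nabla_vfield phi_vfield X Y)+
  have d: "coord k p (u - \<phi> p v) =
      (\<Sum>i\<in>UNIV. \<Sum>j\<in>UNIV. ?x i * ?y j * ((\<Sum>l\<in>UNIV. P j l * \<Gamma> i l k) - (\<Sum>l\<in>UNIV. \<Gamma> i j l * P l k)))"
    (is "_ = ?rhs") for k
  proof -
    have "X p (\<lambda>q. \<Sum>j\<in>UNIV. cf Y j q * P j k) = (\<Sum>j\<in>UNIV. X p (\<lambda>q. P j k * cf Y j q))"
      using tangent_sum[OF T, of UNIV "\<lambda>j q. P j k * cf Y j q"]
      by (simp add: smooth_near_mult smooth_near_const cf_near Y mult.commute)
    also have "\<dots> = (\<Sum>j\<in>UNIV. X p (cf Y j) * P j k)"
      by (simp add: tangent_cmult[OF T] cf_near Y mult.commute)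
    finally have D: "X p (\<lambda>q. \<Sum>j\<in>UNIV. cf Y j q * P j k) = \<dots>" .
    have "(\<Sum>i\<in>UNIV. \<Sum>l\<in>UNIV. ?x i * (\<Sum>j\<in>UNIV. ?y j * P j l) * \<Gamma> i l k) =
        (\<Sum>i\<in>UNIV. \<Sum>j\<in>UNIV. ?x i * ?y j * (\<Sum>l\<in>UNIV. P j l * \<Gamma> i l k))" (is "?s = ?s'")
    proof (rule sum.cong[OF refl])
      fix i
      have "(\<Sum>l\<in>UNIV. ?x i * (\<Sum>j\<in>UNIV. ?y j * P j l) * \<Gamma> i l k) =
          (\<Sum>l\<in>UNIV. \<Sum>j\<in>UNIV. ?x i * ?y j * (P j l * \<Gamma> i l k))"
        by (simp add: sum_distrib_left sum_distrib_right mult_ac)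
      also have "\<dots> = (\<Sum>j\<in>UNIV. \<Sum>l\<in>UNIV. ?x i * ?y j * (P j l * \<Gamma> i l k))"
        by (rule sum.swap)
      finally show "(\<Sum>l\<in>UNIV. ?x i * (\<Sum>j\<in>UNIV. ?y j * P j l) * \<Gamma> i l k) =
          (\<Sum>j\<in>UNIV. ?x i * ?y j * (\<Sum>l\<in>UNIV. P j l * \<Gamma> i l k))"
        by (simp add: sum_distrib_left)
    qed
    then have cu: "coord k p u = (\<Sum>j\<in>UNIV. X p (cf Y j) * P j k) + ?s'"
      using fun_cong[OF cf_nabla[OF X phi_vfield[OF Y], of k], of p] D
      unfolding u_def by (simp add: cf_def[of "nabla _ _"] conn_def cf_phi[OF Y])
    have "coord k p (\<phi> p v) = (\<Sum>l\<in>UNIV. conn X Y l p * P l k)"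
      using coord_phi[OF vT, of k] fun_cong[OF cf_nabla[OF X Y], of _ p]
      unfolding v_def by (simp add: cf_def[of "nabla _ _"])
    also have "\<dots> = (\<Sum>l\<in>UNIV. X p (cf Y l) * P l k) +
        (\<Sum>l\<in>UNIV. \<Sum>i\<in>UNIV. \<Sum>j\<in>UNIV. ?x i * ?y j * (\<Gamma> i j l * P l k))"
      by (simp add: conn_def distrib_right sum.distrib sum_distrib_right mult.assoc)
    also have "(\<Sum>l\<in>UNIV. \<Sum>i\<in>UNIV. \<Sum>j\<in>UNIV. ?x i * ?y j * (\<Gamma> i j l * P l k)) =
        (\<Sum>i\<in>UNIV. \<Sum>j\<in>UNIV. ?x i * ?y j * (\<Sum>l\<in>UNIV. \<Gamma> i j l * P l k))"
      by (subst sum_rotate3) (simp only: sum_distrib_left)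
    finally have cv: "coord k p (\<phi> p v) = (\<Sum>l\<in>UNIV. X p (cf Y l) * P l k) +
        (\<Sum>i\<in>UNIV. \<Sum>j\<in>UNIV. ?x i * ?y j * (\<Sum>l\<in>UNIV. \<Gamma> i j l * P l k))" .
    have "coord k p (u - \<phi> p v) = coord k p u - coord k p (\<phi> p v)"
      using coord_comb[OF uT phi_tangent[OF vT], of k 1 "-1"] by simp
    also have "\<dots> = ?rhs"
      unfolding cu cv by (simp add: right_diff_distrib sum_subtractf)
    finally show ?thesis .
  qed
  have "fundamental_F A \<phi> g X Y Z p = g p (u - \<phi> p v) (Z p)"
    unfolding fundamental_F_def levi_civita_eq u_def v_def ..
  also have "\<dots> = (\<Sum>k\<in>UNIV. \<epsilon> k * coord k p (u - \<phi> p v) * ?z k)"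
    unfolding cf_def
    by (intro metric_expansion vfield_tangent[OF Z] subspace_diff[OF subspace_tangent_space] uT phi_tangent vT)
  also have "\<dots> = (\<Sum>k\<in>UNIV. \<Sum>i\<in>UNIV. \<Sum>j\<in>UNIV. ?x i * ?y j * ?z k * Fc i j k)"
  proof (rule sum.cong[OF refl])
    show "\<epsilon> k * coord k p (u - \<phi> p v) * ?z k = (\<Sum>i\<in>UNIV. \<Sum>j\<in>UNIV. ?x i * ?y j * ?z k * Fc i j k)" for k
      unfolding d Fc_def by (simp only: sum_distrib_left[of "\<epsilon> k"] sum_distrib_right[of _ _ "?z k"])
        (simp only: mult_ac)
  qed
  also have "\<dots> = (\<Sum>i\<in>UNIV. \<Sum>j\<in>UNIV. \<Sum>k\<in>UNIV. ?x i * ?y j * ?z k * Fc i j k)"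
    by (rule sum_rotate3)
  finally show ?thesis .
qed

text \<open>The rows are the coordinate vectors of the basis, so a kernel vector of the transpose is
  a linear relation among the \<open>b i\<close>.\<close>

lemma basis_matrix_invertible:
  fixes b :: "'d \<Rightarrow> 'a tvec"
  assumes "is_basis_of UNIV b (tangent_space A p)"
  shows "invertible (\<chi> i a. coord a p (b i))"
proof -
  let ?B = "\<chi> i a. coord a p (b i)"
  have inj: "inj b" and ind: "independent (range b)" and bT: "b i \<in> tangent_space A p" for i
    using assms span_base[of "b i" "range b"] unfolding is_basis_of_def by auto
  have "y = 0" if y: "transpose ?B *v y = 0" for y :: "real ^ 'd"
  proof -
    let ?v = "\<Sum>i\<in>UNIV. y $ i *\<^sub>R b i"
    have vT: "?v \<in> tangent_space A p"
      by (intro subspace_sum subspace_scale subspace_tangent_space bT)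
    have "coord a p ?v = (\<Sum>i\<in>UNIV. y $ i *\<^sub>R coord a p (b i))" for a
      by (rule linear_on_subspace_sum[OF coord_linear subspace_tangent_space bT])
    moreover have "(\<Sum>i\<in>UNIV. y $ i *\<^sub>R coord a p (b i)) = (transpose ?B *v y) $ a" for a
      by (simp add: matrix_vector_mult_def transpose_def mult.commute)
    ultimately have "coord a p ?v = 0" for a using y by simp
    then have v0: "?v = 0" using expansion[OF vT] by simp
    have "y $ i = 0" for i
    proof (rule ccontr)
      assume "y $ i \<noteq> 0"
      \<comment> \<open>\<open>dependent_finite\<close> takes coefficients indexed by the vectors
        themselves, hence the relabelling along the inverse of \<open>b\<close>.\<close>
      moreover have "(\<Sum>v\<in>range b. y $ (inv_into UNIV b v) *\<^sub>R v) = ?v"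
        by (simp add: sum.reindex[OF inj] inv_f_f[OF inj])
      ultimately have "\<exists>v\<in>range b. y $ (inv_into UNIV b v) \<noteq> 0" "(\<Sum>v\<in>range b. y $ (inv_into UNIV b v) *\<^sub>R v) = 0"
        using v0 inv_f_f[OF inj] by (auto intro: bexI[of _ "b i"])
      then have "dependent (range b)"
        unfolding dependent_finite[OF finite_imageI[OF finite]] by (intro exI[of _ "\<lambda>v. y $ (inv_into UNIV b v)"] conjI)
      with ind show False by simp
    qed
    then show ?thesis by (simp add: vec_eq_iff)
  qed
  then have "invertible (transpose ?B)"
    using matrix_left_invertible_ker[of "transpose ?B"] invertible_left_inverse by blast
  then show ?thesis using transpose_invertible transpose_transpose by metis
qed

text \<open>Writing \<open>B\<close> for the coefficient matrix of the basis and \<open>D\<close> for the diagonal matrix of the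
  signs, the Gram matrix is \<open>B D B\<^sup>T\<close>; hence \<open>B\<^sup>T (B D B\<^sup>T)\<^sup>-\<^sup>1 B = D\<close>.\<close>

lemma inverse_gram_trace:
  assumes "adapted_basis_at A \<xi> b p"
  shows "(\<Sum>i\<in>UNIV. \<Sum>j\<in>UNIV. inverse_gram g b p $ i $ j *
      (\<Sum>k\<in>UNIV. \<Sum>l\<in>UNIV. cf (b i) k p * cf (b j) l p * f k l)) = (\<Sum>k\<in>UNIV. \<epsilon> k * f k k)"
proof -
  have bas: "is_basis_of UNIV (\<lambda>i. b i p) (tangent_space A p)" and bVF: "b i \<in> VF" for i
    using assms unfolding adapted_basis_at_def by auto
  define B :: "real ^ 'd ^ 'd" where "B = (\<chi> i a. cf (b i) a p)"
  define D :: "real ^ 'd ^ 'd" where "D = (\<chi> i j. if i = j then \<epsilon> i else 0)"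
  define G :: "real ^ 'd ^ 'd" where "G = (\<chi> i j. g p (b i p) (b j p))"
  have invB: "invertible B"
    unfolding B_def cf_def using basis_matrix_invertible[OF bas] .
  have mult_D: "(D ** N) $ i $ j = \<epsilon> i * N $ i $ j" for N i j
    by (simp add: D_def matrix_matrix_mult_def if_distrib if_distribR cong: if_cong)
  have DD: "D ** D = mat 1"
    unfolding vec_eq_iff mult_D by (simp add: D_def mat_def eps)
  have G: "G = B ** (D ** transpose B)"
    unfolding vec_eq_iff matrix_matrix_mult_def[of B] vec_lambda_beta mult_D
    by (simp add: G_def B_def transpose_def metric_vfields bVF mult_ac)
  have "invertible D" using DD unfolding invertible_def by blast
  then have "invertible G"
    unfolding G by (intro invertible_mult invB transpose_invertible)
  \<comment> \<open>\<open>matrix_inv\<close> is a choice, meaningful only once the Gram matrix is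
    known to be invertible.\<close>
  then have inv: "G ** matrix_inv G = mat 1" unfolding invertible_def matrix_inv_def by (rule someI2_ex) (rule conjunct1)
  define K where "K = transpose B ** (matrix_inv G ** B)"
  obtain B' where B': "B' ** B = mat 1" using invB unfolding invertible_def by blast
  \<comment> \<open>The Gram matrix cancels against its inverse and leaves \<open>B\<close>.
    Cancelling \<open>B\<close> on the left gives \<open>D ** K = mat 1\<close>, and
    \<open>D\<close> is its own inverse.\<close>
  have "B ** (D ** K) = (G ** matrix_inv G) ** B"
    unfolding K_def G by (simp only: matrix_mul_assoc)
  then have "B' ** (B ** (D ** K)) = B' ** B" unfolding inv by simp
  then have "D ** K = mat 1" by (simp add: matrix_mul_assoc B')
  then have "D ** (D ** K) = D" by simp
  then have K: "K = D" by (simp add: matrix_mul_assoc DD)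
  have entry: "K $ k $ l = (\<Sum>i\<in>UNIV. \<Sum>j\<in>UNIV. cf (b i) k p * inverse_gram g b p $ i $ j * cf (b j) l p)" for k l
    by (simp add: K_def B_def transpose_def matrix_matrix_mult_def inverse_gram_def G_def[symmetric]
        sum_distrib_left mult.assoc)
  have "(\<Sum>i\<in>UNIV. \<Sum>j\<in>UNIV. inverse_gram g b p $ i $ j *
      (\<Sum>k\<in>UNIV. \<Sum>l\<in>UNIV. cf (b i) k p * cf (b j) l p * f k l)) =
      (\<Sum>i\<in>UNIV. \<Sum>j\<in>UNIV. \<Sum>k\<in>UNIV. \<Sum>l\<in>UNIV.
        cf (b i) k p * inverse_gram g b p $ i $ j * cf (b j) l p * f k l)"
    by (simp add: sum_distrib_left mult_ac)
  also have "\<dots> = (\<Sum>i\<in>UNIV. \<Sum>k\<in>UNIV. \<Sum>l\<in>UNIV. \<Sum>j\<in>UNIV.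
        cf (b i) k p * inverse_gram g b p $ i $ j * cf (b j) l p * f k l)"
    by (rule sum.cong[OF refl sum_rotate3])
  also have "\<dots> = (\<Sum>k\<in>UNIV. \<Sum>l\<in>UNIV. \<Sum>i\<in>UNIV. \<Sum>j\<in>UNIV.
        cf (b i) k p * inverse_gram g b p $ i $ j * cf (b j) l p * f k l)"
    by (rule sum_rotate3)
  also have "\<dots> = (\<Sum>k\<in>UNIV. \<Sum>l\<in>UNIV. K $ k $ l * f k l)"
    unfolding entry by (simp add: sum_distrib_right)
  also have "\<dots> = (\<Sum>k\<in>UNIV. \<Sum>l\<in>UNIV. if l = k then \<epsilon> k * f k k else 0)"
    unfolding K by (intro sum.cong) (auto simp: D_def)
  finally show ?thesis by simp
qed

text \<open>Since \<open>S\<close> vanishes on \<xi>, putting z = \<xi> in the formula for F gives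
  F(x, y, \<xi>) = S(x, y), so the first identity of the class is that formula again and the next
  ones are properties of \<open>S\<close>. The first trace is \<eta>(z) tr S + S(\<xi>, z). In the
  second only \<eta>(z) times the trace of S(., \<phi> .) survives, as \<eta> \<circ> \<phi> =
  0.\<close>

lemma class_F6I:
  fixes S :: "'d \<Rightarrow> 'd \<Rightarrow> real"
  assumes ac: "almost_contact_B_metric_manifold A \<phi> (E r) \<eta> g"
    and Fc: "\<And>i j k. Fc i j k = (if j = r then S i k else 0) + (if k = r then S i j else 0)"
    and S_sym: "\<And>i j. S i j = S j i"
    and S_r: "\<And>i. S i r = 0"
    and S_P: "\<And>i j. (\<Sum>a\<in>UNIV. \<Sum>b\<in>UNIV. P i a * P j b * S a b) = - S i j"
    and tr: "(\<Sum>i\<in>UNIV. \<epsilon> i * S i i) = 0"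
    and tr': "(\<Sum>i\<in>UNIV. \<epsilon> i * (\<Sum>j\<in>UNIV. P i j * S i j)) = 0"
  shows "class_F6 A \<phi> (E r) \<eta> g"
proof -
  define s where "s X Y p = (\<Sum>i\<in>UNIV. \<Sum>j\<in>UNIV. cf X i p * cf Y j p * S i j)" for X Y p
  have F: "fundamental_F A \<phi> g X Y Z p = cf Y r p * s X Z p + cf Z r p * s X Y p"
    if "X \<in> VF" "Y \<in> VF" "Z \<in> VF" for X Y Z p
  proof -
    have "fundamental_F A \<phi> g X Y Z p = (\<Sum>i\<in>UNIV. \<Sum>j\<in>UNIV. \<Sum>k\<in>UNIV.
        (if j = r then cf X i p * cf Y r p * cf Z k p * S i k else 0) +
        (if k = r then cf X i p * cf Y j p * cf Z r p * S i j else 0))"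
      unfolding fundamental_F_frame[OF that] Fc by (intro sum.cong) auto
    also have "\<dots> = (\<Sum>i\<in>UNIV. (\<Sum>j\<in>UNIV. if j = r then (\<Sum>k\<in>UNIV. cf X i p * cf Y r p * cf Z k p * S i k) else 0) +
        (\<Sum>j\<in>UNIV. cf X i p * cf Y j p * cf Z r p * S i j))"
      unfolding sum.distrib by (intro arg_cong2[of _ _ _ _ "(+)"] sum.cong) auto
    also have "\<dots> = cf Y r p * s X Z p + cf Z r p * s X Y p"
      by (simp add: s_def sum.distrib sum_distrib_left mult_ac)
    finally show ?thesis .
  qed
  have S_r': "S r j = 0" for j using S_sym[of r j] S_r[of j] by simp
  have s_xi: "s X (E r) p = 0" "s (E r) X p = 0" for X p
    by (simp_all add: s_def cf_frame S_r S_r' if_distrib if_distribR cong: if_cong)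
  have s_sym: "s X Y p = s Y X p" for X Y p
  proof -
    have "cf X i p * cf Y j p * S i j = cf Y j p * cf X i p * S j i" for i j
      using S_sym[of i j] by simp
    then show ?thesis
      unfolding s_def by (subst sum.swap) (simp only:)
  qed
  have s_phi: "s (endo_apply \<phi> X) (endo_apply \<phi> Y) p = - s X Y p" if "X \<in> VF" "Y \<in> VF" for X Y p
  proof -
    have "s (endo_apply \<phi> X) (endo_apply \<phi> Y) p =
        (\<Sum>a\<in>UNIV. \<Sum>b\<in>UNIV. \<Sum>i\<in>UNIV. \<Sum>j\<in>UNIV. cf X i p * cf Y j p * (P i a * P j b * S a b))"
      unfolding s_def cf_phi[OF that(1)] cf_phi[OF that(2)] sum_product
      by (simp only: sum_distrib_right) (simp add: mult_ac)
    also have "\<dots> = (\<Sum>a\<in>UNIV. \<Sum>i\<in>UNIV. \<Sum>j\<in>UNIV. \<Sum>b\<in>UNIV. cf X i p * cf Y j p * (P i a * P j b * S a b))"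
      by (rule sum.cong[OF refl sum_rotate3])
    also have "\<dots> = (\<Sum>i\<in>UNIV. \<Sum>j\<in>UNIV. \<Sum>a\<in>UNIV. \<Sum>b\<in>UNIV. cf X i p * cf Y j p * (P i a * P j b * S a b))"
      by (rule sum_rotate3)
    also have "\<dots> = (\<Sum>i\<in>UNIV. \<Sum>j\<in>UNIV. cf X i p * cf Y j p * - S i j)"
      unfolding S_P[symmetric] by (simp add: sum_distrib_left)
    finally show ?thesis by (simp add: s_def sum_negf)
  qed
  have xi: "cf (E r) r p = 1" for p by (simp add: cf_frame)
  \<comment> \<open>Contracting Z first leaves a double sum of the shape that
    \<open>inverse_gram_trace\<close> evaluates.\<close>
  have tensor: "fundamental_F A \<phi> g X Y Z p =
      (\<Sum>k\<in>UNIV. \<Sum>l\<in>UNIV. cf X k p * cf Y l p * (\<Sum>m\<in>UNIV. cf Z m p * Fc k l m))"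
    if "X \<in> VF" "Y \<in> VF" "Z \<in> VF" for X Y Z p
    unfolding fundamental_F_frame[OF that] by (simp add: sum_distrib_left mult_ac)
  have contract: "(\<Sum>m\<in>UNIV. cf Z m p * Fc k l m) =
      (if l = r then \<Sum>m\<in>UNIV. cf Z m p * S k m else 0) + cf Z r p * S k l" for Z p k l
  proof -
    have "(\<Sum>m\<in>UNIV. cf Z m p * Fc k l m) = (\<Sum>m\<in>UNIV. (if l = r then cf Z m p * S k m else 0) +
        (if m = r then cf Z r p * S k l else 0))"
      unfolding Fc by (intro sum.cong) (auto simp: algebra_simps)
    then show ?thesis by (simp add: sum.distrib)
  qed
  have theta: "theta A \<phi> g b Z p = 0" and theta_star: "theta_star A \<phi> g b Z p = 0"
    if b: "adapted_basis_at A (E r) b p" and Z: "Z \<in> VF" for b Z p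
  proof -
    have bVF: "b i \<in> VF" for i using b unfolding adapted_basis_at_def by auto
    have Sr: "(\<Sum>m\<in>UNIV. cf Z m p * S r m) = 0" by (simp add: S_r')
    have "theta A \<phi> g b Z p = (\<Sum>k\<in>UNIV. \<epsilon> k * (\<Sum>m\<in>UNIV. cf Z m p * Fc k k m))"
      unfolding theta_def tensor[OF bVF bVF Z] by (rule inverse_gram_trace[OF b])
    also have "\<dots> = (\<Sum>k\<in>UNIV. cf Z r p * (\<epsilon> k * S k k))"
      unfolding contract using Sr by (intro sum.cong) auto
    finally show "theta A \<phi> g b Z p = 0" using tr by (simp add: sum_distrib_left[symmetric])
    \<comment> \<open>The matrix of \<phi> is moved from the fields to the form, so that the
      coefficients of the \<open>b j\<close> themselves appear and \<open>inverse_gram_trace\<close>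
      applies.\<close>
    have "fundamental_F A \<phi> g (b i) (endo_apply \<phi> (b j)) Z p =
        (\<Sum>k\<in>UNIV. \<Sum>l\<in>UNIV. cf (b i) k p * cf (b j) l p * (\<Sum>m\<in>UNIV. P l m * (cf Z r p * S k m)))" for i j
    proof -
      have "fundamental_F A \<phi> g (b i) (endo_apply \<phi> (b j)) Z p = cf Z r p * s (b i) (endo_apply \<phi> (b j)) p"
        unfolding F[OF bVF phi_vfield[OF bVF] Z] by (simp add: cf_phi[OF bVF] P_range)
      also have "\<dots> = (\<Sum>k\<in>UNIV. \<Sum>m\<in>UNIV. \<Sum>l\<in>UNIV. cf (b i) k p * cf (b j) l p * (P l m * (cf Z r p * S k m)))"
        unfolding s_def cf_phi[OF bVF] by (simp add: sum_distrib_left sum_distrib_right mult_ac)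
      also have "\<dots> = (\<Sum>k\<in>UNIV. \<Sum>l\<in>UNIV. \<Sum>m\<in>UNIV. cf (b i) k p * cf (b j) l p * (P l m * (cf Z r p * S k m)))"
        by (intro sum.cong refl sum.swap)
      finally show ?thesis by (simp add: sum_distrib_left)
    qed
    then have "theta_star A \<phi> g b Z p =
        (\<Sum>k\<in>UNIV. \<epsilon> k * (\<Sum>m\<in>UNIV. P k m * (cf Z r p * S k m)))"
      unfolding theta_star_def by (simp only: inverse_gram_trace[OF b])
    also have "\<dots> = cf Z r p * (\<Sum>k\<in>UNIV. \<epsilon> k * (\<Sum>m\<in>UNIV. P k m * S k m))"
      by (simp add: sum_distrib_left mult_ac)
    finally show "theta_star A \<phi> g b Z p = 0" using tr' by simp
  qed
  show ?thesis
    unfolding class_F6_def Let_def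
  proof (intro conjI ballI allI impI ac)
    fix X Y p assume XY: "X \<in> VF" "Y \<in> VF"
    show "fundamental_F A \<phi> g X Y Z p =
        \<eta> p (Y p) * fundamental_F A \<phi> g X Z (E r) p + \<eta> p (Z p) * fundamental_F A \<phi> g X Y (E r) p"
      if Z: "Z \<in> VF" for Z
      by (simp add: F XY Z frame eta_vfield s_xi xi)
    show "fundamental_F A \<phi> g (E r) X Y p = 0"
      by (simp add: F XY frame s_xi)
    show "fundamental_F A \<phi> g X Y (E r) p = fundamental_F A \<phi> g Y X (E r) p"
      by (simp add: F XY frame s_xi s_sym[of X Y])
    show "fundamental_F A \<phi> g X Y (E r) p =
        - fundamental_F A \<phi> g (endo_apply \<phi> X) (endo_apply \<phi> Y) (E r) p"
      by (simp add: F XY frame phi_vfield s_xi s_phi xi)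
  qed (fact theta theta_star)+
qed

end

section \<open>The five-dimensional Lie algebra\<close>

text \<open>The basis is numbered from 1 to 5 but lists from 0, hence the shift here and in the
  tables below.\<close>

definition sgn5 :: "nat \<Rightarrow> real" where
  "sgn5 i = [1, 1, -1, -1, 1] ! (i - 1)"

definition phi5 :: "nat \<Rightarrow> nat \<Rightarrow> real" where
  "phi5 i j = [[0, 0, 1, 0, 0], [0, 0, 0, 1, 0], [-1, 0, 0, 0, 0], [0, -1, 0, 0, 0], [0, 0, 0, 0, 0]]
    ! (i - 1) ! (j - 1)"

context
  fixes l1 l2 l3 l4 m1 m3 :: real
begin

text \<open>Row i of the table holds the coefficients of [\<open>e i\<close>, \<xi>], with row 5
  standing for [\<xi>, \<xi>] = 0. Other brackets come from antisymmetry or are 0, the first four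
  fields being abelian.\<close>

definition str5 :: "nat \<Rightarrow> nat \<Rightarrow> nat \<Rightarrow> real" where
  "str5 i j k = (let ad = (\<lambda>i. [[l1, l2, l3, l4, 0], [m1, -l1, m3, -l3, 0], [-l3, -l4, l1, l2, 0],
      [-m3, l3, m1, -l1, 0], [0, 0, 0, 0, 0]] ! (i - 1) ! (k - 1))
    in if j = 5 then ad i else if i = 5 then - ad j else 0)"

definition gamma5 :: "nat \<Rightarrow> nat \<Rightarrow> nat \<Rightarrow> real" where
  "gamma5 i j k = sgn5 k / 2 * (sgn5 k * str5 i j k - sgn5 i * str5 j k i + sgn5 j * str5 k i j)"

end

text \<open>With \<open>x = \<lambda>\<^sub>1\<close>, \<open>y = \<lambda>\<^sub>3\<close>, \<open>z = (\<lambda>\<^sub>2 + \<mu>\<^sub>1) / 2\<close> and \<open>w = (\<lambda>\<^sub>4 + \<mu>\<^sub>3) / 2\<close>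
  these are the values \<open>F(e\<^sub>i, e\<^sub>j, \<xi>)\<close>.\<close>

definition F5 :: "real \<Rightarrow> real \<Rightarrow> real \<Rightarrow> real \<Rightarrow> nat \<Rightarrow> nat \<Rightarrow> real" where
  "F5 x y z w i j = [[y, w, x, z, 0], [w, -y, z, -x, 0], [x, z, -y, -w, 0], [z, -x, -w, y, 0], [0, 0, 0, 0, 0]]
    ! (i - 1) ! (j - 1)"

section \<open>Finite verifications on the tables\<close>

lemma atLeastAtMost_1_5: "{1..5} = {1, 2, 3, 4, 5::nat}"
  by auto

lemma sum_1_5: "(\<Sum>i\<in>{1..5}. h i) = h 1 + h 2 + h 3 + h 4 + h (5::nat)" for h :: "nat \<Rightarrow> real"
  unfolding atLeastAtMost_1_5 by simp

lemma fundamental_coefficients: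
  assumes "i \<in> {1..5}" "j \<in> {1..5}" "k \<in> {1..5}"
  shows "sgn5 k * ((\<Sum>l\<in>{1..5}. phi5 j l * gamma5 l1 l2 l3 l4 m1 m3 i l k) -
      (\<Sum>l\<in>{1..5}. gamma5 l1 l2 l3 l4 m1 m3 i j l * phi5 l k)) =
    (if j = 5 then F5 l1 l3 ((l2 + m1) / 2) ((l4 + m3) / 2) i k else 0) +
    (if k = 5 then F5 l1 l3 ((l2 + m1) / 2) ((l4 + m3) / 2) i j else 0)"
  using assms unfolding atLeastAtMost_1_5
  by (elim insertE emptyE; simp add: sgn5_def phi5_def gamma5_def str5_def F5_def field_simps)

lemma F5_sym:
  assumes "i \<in> {1..5}" "j \<in> {1..5}"
  shows "F5 x y z w i j = F5 x y z w j i"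
  using assms unfolding atLeastAtMost_1_5 by (elim insertE emptyE; simp add: F5_def)

text \<open>On the first four indices the matrix has block rows (a, b) and (b, -a), with a and b
  symmetric and trace-free. The map \<phi> exchanges the two blocks with one change of sign.\<close>

lemma F5_phi:
  assumes "i \<in> {1..5}" "j \<in> {1..5}"
  shows "(\<Sum>a\<in>{1..5}. \<Sum>b\<in>{1..5}. phi5 i a * phi5 j b * F5 x y z w a b) = - F5 x y z w i j"
  unfolding sum_1_5 using assms unfolding atLeastAtMost_1_5
  by (elim insertE emptyE; simp add: F5_def phi5_def)

theorem theorem4p1:
  fixes l1 l2 l3 l4 m1 m3 :: real
    and G :: "'a::{t2_space, second_countable_topology} monoid"
    and A :: "('a, real ^ 'd) atlas"
    and e :: "nat \<Rightarrow> 'a vfield"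
    and \<phi> :: "'a endo" and \<xi> :: "'a vfield" and \<eta> :: "'a oneform" and g :: "'a bilform"
  assumes "CARD('d) = 5"
    and "lie_group G A"
    and "connected (UNIV :: 'a set)"
    and "is_basis_of {1..5} e (lie_algebra G A)"
    and "\<xi> = e 5"
    and "lie_bracket A (e 1) \<xi> =
      l1 *\<^sub>R e 1 + l2 *\<^sub>R e 2 + l3 *\<^sub>R e 3 + l4 *\<^sub>R e 4"
    and "lie_bracket A (e 2) \<xi> =
      m1 *\<^sub>R e 1 - l1 *\<^sub>R e 2 + m3 *\<^sub>R e 3 - l3 *\<^sub>R e 4"
    and "lie_bracket A (e 3) \<xi> =
      - l3 *\<^sub>R e 1 - l4 *\<^sub>R e 2 + l1 *\<^sub>R e 3 + l2 *\<^sub>R e 4"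
    and "lie_bracket A (e 4) \<xi> =
      - m3 *\<^sub>R e 1 + l3 *\<^sub>R e 2 + m1 *\<^sub>R e 3 - l1 *\<^sub>R e 4"
    and "\<forall>i\<in>{1..4}. \<forall>j\<in>{1..4}. lie_bracket A (e i) (e j) = 0"
    and "endo_field A \<phi>" and "oneform_field A \<eta>" and "bilform_field A g"
    and "endo_apply \<phi> (e 1) = e 3" and "endo_apply \<phi> (e 2) = e 4"
    and "endo_apply \<phi> (e 3) = - e 1" and "endo_apply \<phi> (e 4) = - e 2"
    and "endo_apply \<phi> (e 5) = 0"
    and "\<forall>p. \<forall>i\<in>{1..4}. \<eta> p (e i p) = 0" and "\<forall>p. \<eta> p (e 5 p) = 1"
    and "\<forall>p. g p (e 1 p) (e 1 p) = 1 \<and> g p (e 2 p) (e 2 p) = 1 \<and>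
      g p (e 3 p) (e 3 p) = -1 \<and> g p (e 4 p) (e 4 p) = -1 \<and> g p (e 5 p) (e 5 p) = 1"
    and "\<forall>p. \<forall>i\<in>{1..5}. \<forall>j\<in>{1..5}. i \<noteq> j \<longrightarrow> g p (e i p) (e j p) = 0"
  shows "class_F6 A \<phi> \<xi> \<eta> g"
proof -
  let ?c = "str5 l1 l2 l3 l4 m1 m3" and ?\<gamma> = "gamma5 l1 l2 l3 l4 m1 m3" and ?F = "F5 l1 l3 ((l2 + m1) / 2) ((l4 + m3) / 2)"
  \<comment> \<open>The frame is numbered by 1, ..., 5 while bases are indexed by the abstract
    five-element type; \<open>s\<close> translates between the two.\<close>
  obtain s :: "'d \<Rightarrow> nat" where s: "bij_betw s UNIV {1..5}"
    using finite_same_card_bij[of "UNIV :: 'd set" "{1..5::nat}"] assms(1) by auto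
  have s5: "s d \<in> {1..5}" for d using s unfolding bij_betw_def by auto
  have sinj: "s i = s j \<longleftrightarrow> i = j" for i j using s unfolding bij_betw_def inj_def by auto
  define r where "r = inv_into UNIV s 5"
  have sr: "s r = 5"
    unfolding r_def using s by (intro f_inv_into_f) (simp add: bij_betw_def)
  have r: "i = r \<longleftrightarrow> s i = 5" for i using sinj[of i r] sr by simp
  have sum_s: "(\<Sum>d\<in>UNIV. h (s d)) = (\<Sum>i\<in>{1..5}. h i)" for h :: "nat \<Rightarrow> 'v::comm_monoid_add"
    by (rule sum.reindex_bij_betw[OF s])

  have skew: "lie_bracket A X Y = - lie_bracket A Y X" for X Y
    by (simp add: lie_bracket_def fun_eq_iff)
  have self: "lie_bracket A X X = 0" for X
    by (simp add: lie_bracket_def fun_eq_iff)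
  \<comment> \<open>The given brackets have \<xi> in the second slot; \<xi> in the first slot is
    reduced to them by antisymmetry.\<close>
  have br: "lie_bracket A (e i) (e j) = (\<Sum>k\<in>{1..5}. ?c i j k *\<^sub>R e k)" if "i \<in> {1..5}" "j \<in> {1..5}" for i j
  proof (cases "i \<le> 4 \<and> j \<le> 4")
    case True
    then show ?thesis using assms(10) that by (simp add: str5_def)
  next
    case False
    have b5: "lie_bracket A (e i) (e 5) = (\<Sum>k\<in>{1..5}. ?c i 5 k *\<^sub>R e k)" if "i \<in> {1..5}" for i
      using that assms(5-9) self unfolding atLeastAtMost_1_5
      by (elim insertE emptyE; simp add: str5_def algebra_simps)
    show ?thesis
    proof (cases "j = 5")
      case True
      then show ?thesis using b5 that by simp
    next
      case j: False
      with False that have i: "i = 5" by auto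
      have "?c 5 j k = - ?c j 5 k" for k using j by (simp add: str5_def)
      then show ?thesis
        unfolding i skew[of "e 5"] b5[OF that(2)] by (simp add: sum_negf)
    qed
  qed

  interpret frame_structure A g "\<lambda>d. e (s d)" "\<lambda>d. sgn5 (s d)" "\<lambda>i j k. ?c (s i) (s j) (s k)"
    \<phi> \<eta> "\<lambda>j k. phi5 (s j) (s k)" r
  proof
    show "smooth_manifold A" using assms(2) by (simp add: lie_group_def)
    show "bilform_field A g" "endo_field A \<phi>" "oneform_field A \<eta>" by fact+
    show "e (s i) \<in> smooth_vfields A" for i
    proof -
      have "e (s i) \<in> span (e ` {1..5})" using s5 by (intro span_base imageI)
      then show ?thesis using assms(4) unfolding is_basis_of_def lie_algebra_def by auto
    qed
    show "g p (e (s i) p) (e (s j) p) = (if i = j then sgn5 (s i) else 0)" for p i j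
    proof (cases "i = j")
      case True
      then show ?thesis
        using s5[of i] assms(21) unfolding atLeastAtMost_1_5 by (elim insertE emptyE; simp add: sgn5_def)
    next
      case False
      then show ?thesis using assms(22) s5 sinj by simp
    qed
    show "sgn5 (s i) * sgn5 (s i) = 1" for i
      using s5[of i] unfolding atLeastAtMost_1_5 by (elim insertE emptyE; simp add: sgn5_def)
    show "lie_bracket A (e (s i)) (e (s j)) = (\<Sum>k\<in>UNIV. ?c (s i) (s j) (s k) *\<^sub>R e (s k))" for i j
      unfolding sum_s[of "\<lambda>k. ?c (s i) (s j) k *\<^sub>R e k"] by (rule br[OF s5 s5])
    show "\<phi> p (e (s j) p) = (\<Sum>k\<in>UNIV. phi5 (s j) (s k) *\<^sub>R e (s k) p)" for p j
      unfolding sum_s[of "\<lambda>k. phi5 (s j) k *\<^sub>R e k p"]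
      using s5[of j] assms(14-18)[THEN fun_cong, of p] unfolding atLeastAtMost_1_5
      by (elim insertE emptyE; simp add: phi5_def endo_apply_def)
    show "\<eta> p (e (s j) p) = (if j = r then 1 else 0)" for p j
      unfolding r using s5[of j] assms(19,20) by (cases "s j = 5") auto
    show "(\<Sum>l\<in>UNIV. phi5 (s j) (s l) * phi5 (s l) (s k)) = (if j = k \<and> j \<noteq> r then -1 else 0)" for j k
      unfolding sum_s[of "\<lambda>l. phi5 (s j) l * phi5 l (s k)"] r sinj[symmetric, of j k]
      using s5[of j] s5[of k] unfolding atLeastAtMost_1_5 by (elim insertE emptyE; simp add: phi5_def)
    show "phi5 (s j) (s r) = 0" "phi5 (s r) (s j) = 0" for j
      unfolding sr using s5[of j] unfolding atLeastAtMost_1_5 by (elim insertE emptyE; simp add: phi5_def)+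
    show "(\<Sum>k\<in>UNIV. sgn5 (s k) * phi5 (s i) (s k) * phi5 (s j) (s k)) =
        (if i = j \<and> i \<noteq> r then - sgn5 (s i) else 0)" for i j
      unfolding sum_s[of "\<lambda>k. sgn5 k * phi5 (s i) k * phi5 (s j) k"] r sinj[symmetric, of i j]
      using s5[of i] s5[of j] unfolding atLeastAtMost_1_5
      by (elim insertE emptyE; simp add: phi5_def sgn5_def)
    show "sgn5 (s r) = 1" by (simp add: sr sgn5_def)
  qed

  have "has_signature A g 2 (2 + 1)"
  proof (rule frame_has_signature)
    \<comment> \<open>The negative fields \<open>e 3\<close> and \<open>e 4\<close> are put in
      front, as the definition of the signature demands.\<close>
    have "bij_betw ((!) [3, 4, 1, 2, 5]) {..<2 + (2 + 1)} {1..5::nat}"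
      by (rule bij_betw_nth) auto
    then show "bij_betw (inv_into UNIV s \<circ> (!) [3, 4, 1, 2, 5]) {..<2 + (2 + 1)} UNIV"
      using bij_betw_inv_into[OF s] by (rule bij_betw_trans)
    fix i :: nat
    assume i: "i < 2 + (2 + 1)"
    then have "[3, 4, 1, 2, 5::nat] ! i \<in> {1..5}"
      by (auto simp: less_Suc_eq numeral_eq_Suc)
    then have "s (inv_into UNIV s ([3, 4, 1, 2, 5] ! i)) = [3, 4, 1, 2, 5] ! i"
      using s by (intro f_inv_into_f) (simp add: bij_betw_def)
    moreover from i have "i = 0 \<or> i = 1 \<or> i = 2 \<or> i = 3 \<or> i = 4" by auto
    ultimately show "sgn5 (s ((inv_into UNIV s \<circ> (!) [3, 4, 1, 2, 5]) i)) = (if i < 2 then -1 else 1)"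
      by (auto simp: sgn5_def)
  qed
  then have "almost_contact_B_metric_manifold A \<phi> (e (s r)) \<eta> g"
    using assms(1) by (intro almost_contact[of 2]) simp_all
  then have "class_F6 A \<phi> (e (s r)) \<eta> g"
  proof (rule class_F6I[where S="\<lambda>i j. ?F (s i) (s j)"])
    have \<Gamma>: "\<Gamma> i j k = ?\<gamma> (s i) (s j) (s k)" for i j k
      by (simp add: \<Gamma>_def gamma5_def)
    show "Fc i j k = (if j = r then ?F (s i) (s k) else 0) + (if k = r then ?F (s i) (s j) else 0)" for i j k
      unfolding Fc_def \<Gamma> r sum_s[of "\<lambda>l. phi5 (s j) l * ?\<gamma> (s i) l (s k)"]
        sum_s[of "\<lambda>l. ?\<gamma> (s i) (s j) l * phi5 l (s k)"]
      by (rule fundamental_coefficients[OF s5 s5 s5])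
    show "?F (s i) (s j) = ?F (s j) (s i)" for i j by (rule F5_sym[OF s5 s5])
    show "?F (s i) (s r) = 0" for i
      unfolding sr using s5[of i] unfolding atLeastAtMost_1_5 by (elim insertE emptyE; simp add: F5_def)
    show "(\<Sum>a\<in>UNIV. \<Sum>b\<in>UNIV. phi5 (s i) (s a) * phi5 (s j) (s b) * ?F (s a) (s b)) = - ?F (s i) (s j)" for i j
    proof -
      have "(\<Sum>b\<in>UNIV. phi5 (s i) a * phi5 (s j) (s b) * ?F a (s b)) =
          (\<Sum>b\<in>{1..5}. phi5 (s i) a * phi5 (s j) b * ?F a b)" for a
        by (rule sum_s)
      then show ?thesis
        using sum_s[of "\<lambda>a. \<Sum>b\<in>{1..5}. phi5 (s i) a * phi5 (s j) b * ?F a b"] F5_phi[OF s5 s5] by simp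
    qed
    show "(\<Sum>i\<in>UNIV. sgn5 (s i) * ?F (s i) (s i)) = 0"
      unfolding sum_s[of "\<lambda>i. sgn5 i * ?F i i"] unfolding atLeastAtMost_1_5 by (simp add: sgn5_def F5_def)
    have "(\<Sum>j\<in>UNIV. phi5 a (s j) * ?F a (s j)) = (\<Sum>j\<in>{1..5}. phi5 a j * ?F a j)" for a
      by (rule sum_s)
    then have "(\<Sum>i\<in>UNIV. sgn5 (s i) * (\<Sum>j\<in>UNIV. phi5 (s i) (s j) * ?F (s i) (s j))) =
        (\<Sum>i\<in>{1..5}. sgn5 i * (\<Sum>j\<in>{1..5}. phi5 i j * ?F i j))"
      using sum_s[of "\<lambda>i. sgn5 i * (\<Sum>j\<in>{1..5}. phi5 i j * ?F i j)"] by simp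
    \<comment> \<open>This trace is twice that of the off-diagonal block of \<open>F5\<close>, just
      as the previous one is twice that of its diagonal block.\<close>
    also have "\<dots> = 0"
      unfolding atLeastAtMost_1_5 by (simp add: sgn5_def phi5_def F5_def)
    finally show "(\<Sum>i\<in>UNIV. sgn5 (s i) * (\<Sum>j\<in>UNIV. phi5 (s i) (s j) * ?F (s i) (s j))) = 0" .
  qed
  then show ?thesis by (simp add: sr assms(5))
qed

end
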